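(* Let $(B^n,g_B)$ and $(F^m,g_F)$ be Riemannian manifolds with $m=\dim F\ge 2$, let $f$ be a positive smooth function on $B$, let $M=B^n\times_f F^m$ be the warped product with metric $g$, let $\varphi$ be a smooth function on $B$ and $\tilde\varphi=\varphi\circ\pi$ its lift to $M$. Suppose that $(M,g,\nabla\tilde\varphi,\lambda)$ is a gradient Ricci soliton with $\lambda\le 0$ (that is, expanding or steady). Assume that $f$ attains both a maximum and a minimum on $B$. Then $M$ is a Riemannian product, i.e. $f$ is constant.
   Context: Manifolds are smooth and connected. Given Riemannian manifolds $(B^n,g_B)$, $(F^m,g_F)$ of dimensions $n,m$ and a positive smooth function $f$ on $B$, the warped product $B\times_f F$ is the manifold $M=B\times F$ with the metric $g=\pi^*g_B+(f\circ\pi)^2\sigma^*g_F$, where $\pi:B\times F\to B$ and $\sigma:B\times F\to F$ are the projections; $B$ is the base, $F$ the fiber and $f$ the warping function. A gradient Ricci soliton $(M,g,\nabla\psi,\lambda)$ is a complete Riemannian manifold $(M,g)$ with a smooth function $\psi$ on $M$ and a constant $\lambda\in\mathbb{R}$ such that $Ric+\nabla^2\psi=\lambda g$, where $\nabla^2\psi$ is the Hessian of $\psi$. It is expanding, steady or shrinking if $\lambda<0$, $\lambda=0$ or $\lambda>0$, respectively. *)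

theory Defs
  imports "HOL-Analysis.Analysis"
begin

section \<open>Smooth functions on open subsets of Euclidean spaces\<close>

text \<open>Both notions are meant for open sets only. The function may take arbitrary values
  outside the set.\<close>

primrec Ck_on :: "nat \<Rightarrow> 'a::euclidean_space set \<Rightarrow> ('a \<Rightarrow> 'b::real_normed_vector) \<Rightarrow> bool" where
  "Ck_on 0 S h \<longleftrightarrow> continuous_on S h"
| "Ck_on (Suc k) S h \<longleftrightarrow>
     (\<forall>x\<in>S. h differentiable (at x)) \<and> (\<forall>v. Ck_on k S (\<lambda>x. frechet_derivative h (at x) v))"

definition smooth_on :: "'a::euclidean_space set \<Rightarrow> ('a \<Rightarrow> 'b::real_normed_vector) \<Rightarrow> bool" where
  "smooth_on S h \<longleftrightarrow> (\<forall>k. Ck_on k S h)"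


section \<open>Smooth manifolds\<close>

text \<open>A chart is a pair \<open>(U, x)\<close> of a domain and a coordinate map, of which only the values
  on \<open>U\<close> matter. The model space is a Euclidean space \<open>'e\<close>, so a manifold modelled on \<open>'e\<close>
  has dimension \<open>DIM('e)\<close>. The atlas need not be maximal.\<close>

type_synonym ('p, 'e) chart = "'p set \<times> ('p \<Rightarrow> 'e)"

record ('p, 'e) manifold =
  topo :: "'p topology"
  atlas :: "('p, 'e) chart set"

abbreviation points :: "('p, 'e, 'z) manifold_scheme \<Rightarrow> 'p set" where
  "points M \<equiv> topspace (topo M)"

abbreviation chart_dom :: "('p, 'e) chart \<Rightarrow> 'p set" where
  "chart_dom c \<equiv> fst c"

abbreviation coord :: "('p, 'e) chart \<Rightarrow> 'p \<Rightarrow> 'e" where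
  "coord c \<equiv> snd c"

definition uncoord :: "('p, 'e) chart \<Rightarrow> 'e \<Rightarrow> 'p" where
  "uncoord c = inv_into (chart_dom c) (coord c)"

definition is_chart :: "'p topology \<Rightarrow> ('p, 'e::euclidean_space) chart \<Rightarrow> bool" where
  "is_chart X c \<longleftrightarrow> openin X (chart_dom c) \<and> open (coord c ` chart_dom c) \<and>
     homeomorphic_map (subtopology X (chart_dom c)) (top_of_set (coord c ` chart_dom c)) (coord c)"

definition smooth_manifold :: "('p, 'e::euclidean_space) manifold \<Rightarrow> bool" where
  "smooth_manifold M \<longleftrightarrow>
     Hausdorff_space (topo M) \<and> second_countable (topo M) \<and>
     connected_space (topo M) \<and> points M \<noteq> {} \<and>
     (\<forall>c\<in>atlas M. is_chart (topo M) c) \<and> (\<Union>c\<in>atlas M. chart_dom c) = points M \<and>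
     (\<forall>c\<in>atlas M. \<forall>d\<in>atlas M.
        smooth_on (coord c ` (chart_dom c \<inter> chart_dom d)) (coord d \<circ> uncoord c))"

definition smooth_fun :: "('p, 'e::euclidean_space) manifold \<Rightarrow> ('p \<Rightarrow> real) \<Rightarrow> bool" where
  "smooth_fun M h \<longleftrightarrow> (\<forall>c\<in>atlas M. smooth_on (coord c ` chart_dom c) (h \<circ> uncoord c))"

text \<open>The differential at \<open>p\<close> of a map \<open>\<Phi>\<close> between manifolds, read in a chart \<open>c\<close> around \<open>p\<close>
  and a chart \<open>d\<close> around \<open>\<Phi> p\<close>.\<close>

definition coord_diff ::
  "('p, 'a::euclidean_space) chart \<Rightarrow> ('q, 'b::euclidean_space) chart \<Rightarrow> ('p \<Rightarrow> 'q) \<Rightarrow> 'p \<Rightarrow> 'a \<Rightarrow> 'b"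
  where "coord_diff c d \<Phi> p = frechet_derivative (coord d \<circ> \<Phi> \<circ> uncoord c) (at (coord c p))"

definition prod_manifold ::
  "('p, 'a::euclidean_space) manifold \<Rightarrow> ('q, 'b::euclidean_space) manifold
     \<Rightarrow> ('p \<times> 'q, 'a \<times> 'b) manifold" where
  "prod_manifold B F =
     \<lparr>topo = prod_topology (topo B) (topo F),
      atlas = {(chart_dom c \<times> chart_dom d, map_prod (coord c) (coord d)) | c d.
               c \<in> atlas B \<and> d \<in> atlas F}\<rparr>"


section \<open>Riemannian metrics\<close>

text \<open>A field of bilinear forms on the tangent spaces is given by its components:
  \<open>g c p u v\<close> is the value at \<open>p\<close> on the tangent vectors whose coordinates in the
  chart \<open>c\<close> are \<open>u\<close> and \<open>v\<close>. The last condition on a metric is the transformation law of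
  covariant tensors under a change of charts.\<close>

type_synonym ('p, 'e) tensor2 = "('p, 'e) chart \<Rightarrow> 'p \<Rightarrow> 'e \<Rightarrow> 'e \<Rightarrow> real"

definition riemannian_metric ::
  "('p, 'e::euclidean_space) manifold \<Rightarrow> ('p, 'e) tensor2 \<Rightarrow> bool" where
  "riemannian_metric M g \<longleftrightarrow>
     (\<forall>c\<in>atlas M. \<forall>p\<in>chart_dom c. bilinear (g c p) \<and> (\<forall>u v. g c p u v = g c p v u) \<and>
        (\<forall>u. u \<noteq> 0 \<longrightarrow> 0 < g c p u u)) \<and>
     (\<forall>c\<in>atlas M. \<forall>u v. smooth_on (coord c ` chart_dom c) (\<lambda>x. g c (uncoord c x) u v)) \<and>
     (\<forall>c\<in>atlas M. \<forall>d\<in>atlas M. \<forall>p\<in>chart_dom c \<inter> chart_dom d. \<forall>u v.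
        g c p u v = g d p (coord_diff c d id p u) (coord_diff c d id p v))"

definition riemannian_manifold ::
  "('p, 'e::euclidean_space) manifold \<Rightarrow> ('p, 'e) tensor2 \<Rightarrow> bool" where
  "riemannian_manifold M g \<longleftrightarrow> smooth_manifold M \<and> riemannian_metric M g"

text \<open>Pullback along a smooth map \<open>\<Phi>\<close> into \<open>N\<close>. By the transformation law the result does
  not depend on the chosen chart around \<open>\<Phi> p\<close>.\<close>

definition pullback ::
  "('q, 'b::euclidean_space) manifold \<Rightarrow> ('p \<Rightarrow> 'q) \<Rightarrow> ('q, 'b) tensor2
     \<Rightarrow> ('p, 'a::euclidean_space) tensor2" where
  "pullback N \<Phi> g = (\<lambda>c p u v.
     let d = (SOME d. d \<in> atlas N \<and> \<Phi> p \<in> chart_dom d)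
     in g d (\<Phi> p) (coord_diff c d \<Phi> p u) (coord_diff c d \<Phi> p v))"

text \<open>The metric of \<open>B \<times>\<^sub>f F\<close>, on the manifold \<open>prod_manifold B F\<close>.\<close>

definition warped_metric ::
  "('p, 'a::euclidean_space) manifold \<Rightarrow> ('p, 'a) tensor2 \<Rightarrow>
   ('q, 'b::euclidean_space) manifold \<Rightarrow> ('q, 'b) tensor2 \<Rightarrow> ('p \<Rightarrow> real)
     \<Rightarrow> ('p \<times> 'q, 'a \<times> 'b) tensor2" where
  "warped_metric B gB F gF f = (\<lambda>c p u v.
     pullback B fst gB c p u v + ((f \<circ> fst) p)\<^sup>2 * pullback F snd gF c p u v)"


section \<open>Levi-Civita connection, Ricci tensor and Hessian in a chart\<close>

text \<open>Here \<open>G x\<close> is the bilinear form of a metric at the point with coordinates \<open>x\<close>, and vectors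
  \<open>u\<close>, \<open>v\<close>, \<open>w\<close> stand for the coordinate vector fields with these constant components.
  All Lie brackets of such fields vanish.\<close>

definition dir_deriv :: "('e::real_normed_vector \<Rightarrow> 'b::real_normed_vector) \<Rightarrow> 'e \<Rightarrow> 'e \<Rightarrow> 'b" where
  "dir_deriv h v x = frechet_derivative h (at x) v"

text \<open>\<open>christoffel G x u v\<close> has the components \<open>\<Sum>i j. \<Gamma>\<^sup>k\<^sub>i\<^sub>j u\<^sub>i v\<^sub>j\<close>. It is determined by
  the Koszul formula.\<close>

definition christoffel ::
  "('e::euclidean_space \<Rightarrow> 'e \<Rightarrow> 'e \<Rightarrow> real) \<Rightarrow> 'e \<Rightarrow> 'e \<Rightarrow> 'e \<Rightarrow> 'e" where
  "christoffel G x u v = (THE z. \<forall>w. 2 * G x z w =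
     dir_deriv (\<lambda>y. G y v w) u x + dir_deriv (\<lambda>y. G y u w) v x - dir_deriv (\<lambda>y. G y u v) w x)"

definition cov_deriv ::
  "('e::euclidean_space \<Rightarrow> 'e \<Rightarrow> 'e \<Rightarrow> real) \<Rightarrow> 'e \<Rightarrow> ('e \<Rightarrow> 'e) \<Rightarrow> 'e \<Rightarrow> 'e" where
  "cov_deriv G u Y x = dir_deriv Y u x + christoffel G x u (Y x)"

definition riemann ::
  "('e::euclidean_space \<Rightarrow> 'e \<Rightarrow> 'e \<Rightarrow> real) \<Rightarrow> 'e \<Rightarrow> 'e \<Rightarrow> 'e \<Rightarrow> 'e \<Rightarrow> 'e" where
  "riemann G x u v w =
     cov_deriv G u (cov_deriv G v (\<lambda>_. w)) x - cov_deriv G v (cov_deriv G u (\<lambda>_. w)) x"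

text \<open>The trace of \<open>u \<mapsto> R(u, v) w\<close>; a trace may be computed in any basis.\<close>

definition ricci ::
  "('e::euclidean_space \<Rightarrow> 'e \<Rightarrow> 'e \<Rightarrow> real) \<Rightarrow> 'e \<Rightarrow> 'e \<Rightarrow> 'e \<Rightarrow> real" where
  "ricci G x v w = (\<Sum>b\<in>Basis. riemann G x b v w \<bullet> b)"

definition hessian ::
  "('e::euclidean_space \<Rightarrow> 'e \<Rightarrow> 'e \<Rightarrow> real) \<Rightarrow> ('e \<Rightarrow> real) \<Rightarrow> 'e \<Rightarrow> 'e \<Rightarrow> 'e \<Rightarrow> real" where
  "hessian G h x u v = dir_deriv (dir_deriv h v) u x - dir_deriv h (cov_deriv G u (\<lambda>_. v) x) x"

definition in_coords :: "('p, 'e) tensor2 \<Rightarrow> ('p, 'e) chart \<Rightarrow> 'e \<Rightarrow> 'e \<Rightarrow> 'e \<Rightarrow> real" where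
  "in_coords g c x = g c (uncoord c x)"

definition ricci_tensor :: "('p, 'e::euclidean_space) tensor2 \<Rightarrow> ('p, 'e) tensor2" where
  "ricci_tensor g = (\<lambda>c p. ricci (in_coords g c) (coord c p))"

definition hessian_tensor ::
  "('p, 'e::euclidean_space) tensor2 \<Rightarrow> ('p \<Rightarrow> real) \<Rightarrow> ('p, 'e) tensor2" where
  "hessian_tensor g h = (\<lambda>c p. hessian (in_coords g c) (h \<circ> uncoord c) (coord c p))"


section \<open>Completeness\<close>

text \<open>A geodesic defined on the whole real line, via the equation \<open>x'' + \<Gamma>(x', x') = 0\<close> for
  its coordinates \<open>x\<close>.\<close>

definition geodesic_line ::
  "('p, 'e::euclidean_space) manifold \<Rightarrow> ('p, 'e) tensor2 \<Rightarrow> (real \<Rightarrow> 'p) \<Rightarrow> bool" where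
  "geodesic_line M g \<gamma> \<longleftrightarrow> continuous_map euclideanreal (topo M) \<gamma> \<and>
     (\<forall>c\<in>atlas M. \<forall>t. \<gamma> t \<in> chart_dom c \<longrightarrow>
        (let x = coord c \<circ> \<gamma>; x' = (\<lambda>s. vector_derivative x (at s))
         in x differentiable (at t) \<and>
            (x' has_vector_derivative - christoffel (in_coords g c) (x t) (x' t) (x' t)) (at t)))"

text \<open>Geodesic completeness, which for connected manifolds amounts to completeness as a metric
  space (Hopf-Rinow).\<close>

definition complete_riemannian_manifold ::
  "('p, 'e::euclidean_space) manifold \<Rightarrow> ('p, 'e) tensor2 \<Rightarrow> bool" where
  "complete_riemannian_manifold M g \<longleftrightarrow> riemannian_manifold M g \<and>
     (\<forall>c\<in>atlas M. \<forall>p\<in>chart_dom c. \<forall>v. \<exists>\<gamma>. geodesic_line M g \<gamma> \<and> \<gamma> 0 = p \<and>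
        vector_derivative (coord c \<circ> \<gamma>) (at 0) = v)"


section \<open>Gradient Ricci solitons\<close>

definition gradient_ricci_soliton ::
  "('p, 'e::euclidean_space) manifold \<Rightarrow> ('p, 'e) tensor2 \<Rightarrow> ('p \<Rightarrow> real) \<Rightarrow> real \<Rightarrow> bool" where
  "gradient_ricci_soliton M g \<psi> lam \<longleftrightarrow>
     complete_riemannian_manifold M g \<and> smooth_fun M \<psi> \<and>
     (\<forall>c\<in>atlas M. \<forall>p\<in>chart_dom c. \<forall>u v.
        ricci_tensor g c p u v + hessian_tensor g \<psi> c p u v = lam * g c p u v)"

end

theory Submission
  imports Defs
begin

text \<open>On vertical vectors the soliton equation reads
  \<open>Ric\<^sub>F = (lam f\<^sup>2 + f \<Delta>f + (m - 1) |\<nabla>f|\<^sup>2 - f \<langle>\<nabla>\<phi>, \<nabla>f\<rangle>) g\<^sub>F\<close>. The left side lives on \<open>F\<close> and the factor on \<open>B\<close>,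
  so the factor is a constant \<open>\<mu>\<close>. Evaluating it at a maximum \<open>p\<close> and at a minimum \<open>q\<close> of \<open>f\<close>, where
  \<open>\<nabla>f = 0\<close> and \<open>\<Delta>f\<close> has a sign, gives \<open>lam (f q)\<^sup>2 \<le> \<mu> \<le> lam (f p)\<^sup>2\<close>. If \<open>lam < 0\<close>, this forces
  \<open>f p \<le> f q\<close>. If \<open>lam = 0\<close>, then \<open>\<mu> = 0\<close> and the equation for \<open>f\<close> is elliptic without zeroth order term,
  so Hopf's strong maximum principle and connectedness apply.\<close>

section \<open>The strong maximum principle\<close>

text \<open>The constant is pinned down by one point of \<open>F\<close> and one nonzero vertical
  vector, fixed before any chart of \<open>B\<close> is chosen; it is a quotient of two numbers. Of
  the curvature of the product only two blocks enter, the base part of \<open>R(e,v)w\<close> for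
  horizontal \<open>e\<close> and the fibre part for vertical \<open>e\<close>, since the coordinate
  trace sees nothing else.

  The obstacle is regularity. Christoffel symbols are given by a definite description, while the
  Ricci tensor differentiates them. The Koszul formula turns them into sums of derivatives of the
  metric times the inverse metric, so everything rests on differentiating the inverse metric, which
  is done by a direct estimate. The Laplacian occurs as divergence of the gradient and is brought to
  the form a_ij d_i d_j + b_j d_j with continuous coefficients. That form serves twice: its sign at
  an extremum is linear algebra, and it is the form to which Hopf's argument applies.\<close>

lemma dir_deriv_eq:
  assumes "(h has_derivative h') (at x)"
  shows "dir_deriv h v x = h' v"
  using frechet_derivative_at[OF assms] by (simp add: dir_deriv_def)

lemma smooth_on_differentiable:
  assumes "smooth_on S h" "x \<in> S"
  shows "h differentiable (at x)"
  using assms unfolding smooth_on_def by (metis Ck_on.simps(2))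

lemma has_derivative_dir_deriv:
  "h differentiable (at x) \<Longrightarrow> (h has_derivative (\<lambda>v. dir_deriv h v x)) (at x)"
  unfolding dir_deriv_def by (simp add: frechet_derivative_works)

lemma smooth_on_has_derivative:
  "smooth_on S h \<Longrightarrow> x \<in> S \<Longrightarrow> (h has_derivative (\<lambda>v. dir_deriv h v x)) (at x)"
  by (intro has_derivative_dir_deriv smooth_on_differentiable)

lemma smooth_on_dir_deriv:
  assumes "smooth_on S h"
  shows "smooth_on S (dir_deriv h v)"
proof -
  have "dir_deriv h v = (\<lambda>x. frechet_derivative h (at x) v)"
    by (auto simp: dir_deriv_def)
  then show ?thesis
    using assms unfolding smooth_on_def by (metis Ck_on.simps(2))
qed

lemma smooth_on_continuous:
  assumes "smooth_on S h"
  shows "continuous_on S h"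
  using assms unfolding smooth_on_def by (metis Ck_on.simps(1))

section \<open>Elliptic operators at an interior maximum\<close>

text \<open>Completing the square in the \<open>k\<close>-th variable: \<open>a\<close> is its Schur
  complement plus the rank one matrix a_ik a_jk / a_kk. Pairing \<open>H\<close> with the rank one
  part evaluates the form of \<open>H\<close> on the \<open>k\<close>-th column of \<open>a\<close>,
  hence is nonpositive; the Schur complement is again positive definite, and the induction
  hypothesis covers it.\<close>

lemma trace_pos_neg_definite:
  fixes a H :: "'i \<Rightarrow> 'i \<Rightarrow> real"
  assumes "finite I"
    and "\<And>i j. i \<in> I \<Longrightarrow> j \<in> I \<Longrightarrow> a i j = a j i"
    and "\<And>\<xi>. \<exists>i\<in>I. \<xi> i \<noteq> 0 \<Longrightarrow> 0 < (\<Sum>i\<in>I. \<Sum>j\<in>I. a i j * \<xi> i * \<xi> j)"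
    and "\<And>\<xi>. (\<Sum>i\<in>I. \<Sum>j\<in>I. H i j * \<xi> i * \<xi> j) \<le> 0"
  shows "(\<Sum>i\<in>I. \<Sum>j\<in>I. a i j * H i j) \<le> 0"
  using assms
proof (induction I arbitrary: a rule: finite_induct)
  case empty
  then show ?case by simp
next
  case (insert k I)
  note sym = insert.prems(1) and pos = insert.prems(2) and neg = insert.prems(3)
  have split: "(\<Sum>i\<in>insert k I. \<Sum>j\<in>insert k I. F i j)
      = F k k + (\<Sum>j\<in>I. F k j) + (\<Sum>i\<in>I. F i k) + (\<Sum>i\<in>I. \<Sum>j\<in>I. F i j)"
    for F :: "'i \<Rightarrow> 'i \<Rightarrow> real"
    using insert.hyps by (simp add: sum.distrib)
  have ne: "i \<in> I \<Longrightarrow> i \<noteq> k" for i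
    using insert.hyps by auto
  have akk: "0 < a k k"
    using pos[of "\<lambda>i. if i = k then 1 else 0"] ne by (simp add: split cong: sum.cong_simp)
  define c where "c i j = a i j - a i k * a k j / a k k" for i j
  have ck: "c k j = 0" "c i k = 0" for i j
    using akk by (auto simp: c_def)
  have "(\<Sum>i\<in>I. \<Sum>j\<in>I. c i j * H i j) \<le> 0"
  proof (rule insert.IH)
    show "c i j = c j i" if "i \<in> I" "j \<in> I" for i j
      unfolding c_def using sym[of i j] sym[of i k] sym[of j k] that by simp
  next
    fix \<xi> :: "'i \<Rightarrow> real"
    assume nz: "\<exists>i\<in>I. \<xi> i \<noteq> 0"
    define s where "s = (\<Sum>j\<in>I. a k j * \<xi> j)"
    \<comment> \<open>The \<open>k\<close>-th entry minimizes the form of \<open>a\<close> while the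
      others are kept at \<xi>; the minimum is the form of the Schur complement \<open>c\<close> at
      \<xi>.\<close>
    define \<eta> where "\<eta> i = (if i = k then - s / a k k else \<xi> i)" for i
    have \<eta>: "\<eta> k = - s / a k k" "i \<in> I \<Longrightarrow> \<eta> i = \<xi> i" for i
      using ne by (auto simp: \<eta>_def)
    have s': "s = (\<Sum>j\<in>I. a j k * \<xi> j)"
      unfolding s_def by (intro sum.cong refl) (simp add: sym)
    have 1: "(\<Sum>j\<in>I. a k j * \<eta> k * \<eta> j) = - (s^2) / a k k"
      by (simp add: \<eta> s_def power2_eq_square sum_distrib_left sum_distrib_right sum_divide_distrib mult_ac
          sum_negf[symmetric] cong: sum.cong_simp)
    have 2: "(\<Sum>i\<in>I. a i k * \<eta> i * \<eta> k) = - (s^2) / a k k"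
      unfolding 1[symmetric] by (intro sum.cong refl) (simp add: sym)
    have 3: "(\<Sum>i\<in>I. \<Sum>j\<in>I. a i k * a k j / a k k * \<xi> i * \<xi> j) = s^2 / a k k"
    proof -
      have "s^2 = (\<Sum>i\<in>I. a i k * \<xi> i) * (\<Sum>j\<in>I. a k j * \<xi> j)"
        using s' by (simp add: s_def power2_eq_square)
      then show ?thesis
        by (simp add: sum_product sum_divide_distrib mult_ac)
    qed
    have "0 < (\<Sum>i\<in>insert k I. \<Sum>j\<in>insert k I. a i j * \<eta> i * \<eta> j)"
      using nz by (intro pos) (auto simp: \<eta>)
    also have "\<dots> = (\<Sum>i\<in>I. \<Sum>j\<in>I. a i j * \<xi> i * \<xi> j) - s^2 / a k k"
      unfolding split 1 2 using akk by (simp add: \<eta> power2_eq_square cong: sum.cong_simp)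
    also have "\<dots> = (\<Sum>i\<in>I. \<Sum>j\<in>I. c i j * \<xi> i * \<xi> j)"
      unfolding 3[symmetric] by (simp add: c_def sum_subtractf left_diff_distrib)
    finally show "0 < (\<Sum>i\<in>I. \<Sum>j\<in>I. c i j * \<xi> i * \<xi> j)" .
  next
    fix \<xi> :: "'i \<Rightarrow> real"
    show "(\<Sum>i\<in>I. \<Sum>j\<in>I. H i j * \<xi> i * \<xi> j) \<le> 0"
      using neg[of "\<lambda>i. if i = k then 0 else \<xi> i"] ne by (simp add: split cong: sum.cong_simp)
  qed
  moreover have "(\<Sum>i\<in>insert k I. \<Sum>j\<in>insert k I. a i j * H i j)
      = (\<Sum>i\<in>I. \<Sum>j\<in>I. c i j * H i j)
        + (\<Sum>i\<in>insert k I. \<Sum>j\<in>insert k I. H i j * a i k * a j k) / a k k"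
  proof -
    have "(\<Sum>i\<in>I. \<Sum>j\<in>I. c i j * H i j) = (\<Sum>i\<in>insert k I. \<Sum>j\<in>insert k I. c i j * H i j)"
      by (simp add: split ck)
    then have "(\<Sum>i\<in>I. \<Sum>j\<in>I. c i j * H i j) + (\<Sum>i\<in>insert k I. \<Sum>j\<in>insert k I. H i j * a i k * a j k) / a k k
      = (\<Sum>i\<in>insert k I. \<Sum>j\<in>insert k I. c i j * H i j + H i j * a i k * a j k / a k k)"
      by (simp only: sum.distrib sum_divide_distrib)
    also have "\<dots> = (\<Sum>i\<in>insert k I. \<Sum>j\<in>insert k I. a i j * H i j)"
      by (intro sum.cong refl) (simp add: c_def sym algebra_simps)
    finally show ?thesis by simp
  qed
  moreover have "(\<Sum>i\<in>insert k I. \<Sum>j\<in>insert k I. H i j * a i k * a j k) / a k k \<le> 0"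
    using neg akk by (simp add: divide_nonpos_pos)
  ultimately show ?case by linarith
qed

text \<open>With \<open>D\<close> positive, \<phi>' would be positive just to the right of 0, and
  the mean value theorem would lift \<phi> above its value at 0.\<close>

lemma second_derivative_at_max:
  fixes \<phi> \<phi>' :: "real \<Rightarrow> real"
  assumes "0 < d"
    and der: "\<And>t. \<bar>t\<bar> < d \<Longrightarrow> (\<phi> has_real_derivative \<phi>' t) (at t)"
    and der2: "(\<phi>' has_real_derivative D) (at 0)"
    and "\<phi>' 0 = 0"
    and max: "\<And>t. \<bar>t\<bar> < d \<Longrightarrow> \<phi> t \<le> \<phi> 0"
  shows "D \<le> 0"
proof (rule ccontr)
  assume "\<not> D \<le> 0"
  then obtain e where e: "0 < e" "\<And>h. 0 < h \<Longrightarrow> h < e \<Longrightarrow> 0 < \<phi>' h"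
    using DERIV_pos_inc_right[OF der2] \<open>\<phi>' 0 = 0\<close> by auto
  define s where "s = min d e / 2"
  have s: "0 < s" "s < d" "s < e"
    using \<open>0 < d\<close> \<open>0 < e\<close> by (auto simp: s_def)
  obtain z where "0 < z" "z < s" "\<phi> s - \<phi> 0 = (s - 0) * \<phi>' z"
    using MVT2[of 0 s \<phi> \<phi>'] der s by force
  moreover have "0 < s * \<phi>' z"
    using e(2)[of z] \<open>0 < z\<close> \<open>z < s\<close> s by simp
  ultimately show False
    using max[of s] s by simp
qed

lemma critical_point_at_max:
  fixes u :: "'e::euclidean_space \<Rightarrow> real"
  assumes "open S" "w \<in> S" "(u has_derivative u') (at w)" "\<And>x. x \<in> S \<Longrightarrow> u x \<le> u w"
  shows "u' v = 0"
  using differential_zero_maxmin[OF assms(2,1,3)] assms(4) by auto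

text \<open>Restriction to the line through \<open>w\<close> in direction \<xi>. The derivatives
  \<open>u1\<close> and \<open>u2\<close> are data rather than values of \<open>dir_deriv\<close>,
  so that a function plus a barrier, or the negative of a function, can be treated directly.\<close>

lemma hessian_at_max:
  fixes u :: "'e::euclidean_space \<Rightarrow> real"
  assumes S: "open S" "w \<in> S"
    and u1: "\<And>x. x \<in> S \<Longrightarrow> (u has_derivative (\<lambda>v. u1 v x)) (at x)"
    and u2: "(u1 \<xi> has_derivative u2) (at w)"
    and max: "\<And>x. x \<in> S \<Longrightarrow> u x \<le> u w"
  shows "u2 \<xi> \<le> 0"
proof -
  have "isCont (\<lambda>t. w + t *\<^sub>R \<xi>) (0::real)"
    by (intro continuous_intros)
  then have "\<forall>\<^sub>F t in at (0::real). w + t *\<^sub>R \<xi> \<in> S"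
    using S by (simp add: isCont_def tendsto_def)
  then obtain d where d: "0 < d" "\<And>t::real. t \<noteq> 0 \<Longrightarrow> \<bar>t\<bar> < d \<Longrightarrow> w + t *\<^sub>R \<xi> \<in> S"
    by (auto simp: eventually_at dist_real_def)
  then have inS: "\<bar>t\<bar> < d \<Longrightarrow> w + t *\<^sub>R \<xi> \<in> S" for t :: real
    using S by (cases "t = 0") auto
  have line: "((\<lambda>t. w + t *\<^sub>R \<xi>) has_derivative (\<lambda>h. h *\<^sub>R \<xi>)) (at (t::real))" for t
    by (auto intro!: derivative_eq_intros)
  show ?thesis
  proof (rule second_derivative_at_max[OF d(1)])
    fix t :: real
    assume t: "\<bar>t\<bar> < d"
    have "((\<lambda>t. u (w + t *\<^sub>R \<xi>)) has_derivative (\<lambda>h. u1 (h *\<^sub>R \<xi>) (w + t *\<^sub>R \<xi>))) (at t)"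
      using has_derivative_compose[OF line u1[OF inS[OF t]]] .
    moreover have "linear (\<lambda>v. u1 v (w + t *\<^sub>R \<xi>))"
      using u1[OF inS[OF t]] by (simp add: has_derivative_def bounded_linear.linear)
    ultimately show "((\<lambda>t. u (w + t *\<^sub>R \<xi>)) has_real_derivative u1 \<xi> (w + t *\<^sub>R \<xi>)) (at t)"
      using linear_cmul[of "\<lambda>v. u1 v (w + t *\<^sub>R \<xi>)"]
      by (simp add: has_field_derivative_def mult.commute[of _ "u1 \<xi> _"])
    show "u (w + t *\<^sub>R \<xi>) \<le> u (w + 0 *\<^sub>R \<xi>)"
      using max[OF inS[OF t]] by simp
  next
    have "(u1 \<xi> has_derivative u2) (at (w + 0 *\<^sub>R \<xi>))"
      using u2 by simp
    from has_derivative_compose[OF line this]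
    have "((\<lambda>t. u1 \<xi> (w + t *\<^sub>R \<xi>)) has_derivative (\<lambda>h. u2 (h *\<^sub>R \<xi>))) (at 0)" .
    moreover have "linear u2"
      using u2 by (simp add: has_derivative_def bounded_linear.linear)
    ultimately show "((\<lambda>t. u1 \<xi> (w + t *\<^sub>R \<xi>)) has_real_derivative u2 \<xi>) (at 0)"
      by (simp add: has_field_derivative_def linear_cmul mult.commute[of _ "u2 \<xi>"])
    show "u1 \<xi> (w + 0 *\<^sub>R \<xi>) = 0"
      using critical_point_at_max[OF S u1[OF S(2)] max] by simp
  qed
qed

lemma linear_basis_sum:
  fixes h :: "'e::euclidean_space \<Rightarrow> 'v::real_vector"
  assumes "linear h"
  shows "h v = (\<Sum>i\<in>Basis. (v \<bullet> i) *\<^sub>R h i)"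
proof -
  have "h v = h (\<Sum>i\<in>Basis. (v \<bullet> i) *\<^sub>R i)"
    by (simp add: euclidean_representation)
  also have "\<dots> = (\<Sum>i\<in>Basis. (v \<bullet> i) *\<^sub>R h i)"
    by (simp add: linear_sum[OF assms] linear_cmul[OF assms])
  finally show ?thesis .
qed

text \<open>The second derivative is nonpositive along every line, and pairing it with a positive
  definite matrix keeps the sign.\<close>

lemma elliptic_at_max:
  fixes u :: "'e::euclidean_space \<Rightarrow> real"
  assumes S: "open S" "w \<in> S"
    and u1: "\<And>x. x \<in> S \<Longrightarrow> (u has_derivative (\<lambda>v. u1 v x)) (at x)"
    and u2: "\<And>v. (u1 v has_derivative u2 v) (at w)"
    and max: "\<And>x. x \<in> S \<Longrightarrow> u x \<le> u w"
    and a_sym: "\<And>i j. i \<in> Basis \<Longrightarrow> j \<in> Basis \<Longrightarrow> a i j = a j i"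
    and a_pos: "\<And>\<xi>::'e. \<xi> \<noteq> 0 \<Longrightarrow> 0 < (\<Sum>i\<in>Basis. \<Sum>j\<in>Basis. a i j * (\<xi> \<bullet> i) * (\<xi> \<bullet> j))"
  shows "(\<Sum>i\<in>Basis. \<Sum>j\<in>Basis. a i j * u2 j i) \<le> 0"
proof (rule trace_pos_neg_definite)
  fix \<xi> :: "'e \<Rightarrow> real"
  define X where "X = (\<Sum>i\<in>Basis. \<xi> i *\<^sub>R i)"
  have X: "X \<bullet> i = \<xi> i" if "i \<in> Basis" for i
    using that by (simp add: X_def)
  show "0 < (\<Sum>i\<in>Basis. \<Sum>j\<in>Basis. a i j * \<xi> i * \<xi> j)" if "\<exists>i\<in>Basis. \<xi> i \<noteq> 0"
  proof -
    have "X \<noteq> 0"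
      using that X by (metis inner_zero_left)
    then show ?thesis
      using a_pos[of X] X by (simp cong: sum.cong_simp)
  qed
  have lin1: "linear (\<lambda>v. u1 v x)" if "x \<in> S" for x
    using u1[OF that] by (simp add: has_derivative_def bounded_linear.linear)
  have lin2: "linear (u2 v)" for v
    using u2 by (simp add: has_derivative_def bounded_linear.linear)
  have "u2 X X \<le> 0"
    by (rule hessian_at_max[OF S u1 u2 max])
  \<comment> \<open>\<open>u1\<close> is linear in its direction and derivatives are unique, so
    \<open>u2\<close> is linear in its first argument as well. This identifies the double sum with
    the second derivative along \<open>X\<close>.\<close>
  moreover have "u2 X = (\<lambda>h. \<Sum>j\<in>Basis. (X \<bullet> j) *\<^sub>R u2 j h)"
  proof -
    have "((\<lambda>x. \<Sum>j\<in>Basis. (X \<bullet> j) *\<^sub>R u1 j x) has_derivative (\<lambda>h. \<Sum>j\<in>Basis. (X \<bullet> j) *\<^sub>R u2 j h)) (at w)"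
      by (intro has_derivative_sum has_derivative_scaleR_right u2)
    then have "(u1 X has_derivative (\<lambda>h. \<Sum>j\<in>Basis. (X \<bullet> j) *\<^sub>R u2 j h)) (at w)"
      by (rule has_derivative_transform_within_open[OF _ S]) (metis linear_basis_sum lin1)
    then show ?thesis
      using u2 has_derivative_unique by blast
  qed
  ultimately have "(\<Sum>i\<in>Basis. (X \<bullet> i) *\<^sub>R (\<Sum>j\<in>Basis. (X \<bullet> j) *\<^sub>R u2 j i)) \<le> 0"
    by (metis linear_basis_sum lin2)
  then show "(\<Sum>i\<in>Basis. \<Sum>j\<in>Basis. u2 j i * \<xi> i * \<xi> j) \<le> 0"
    by (simp add: X sum_distrib_left mult_ac cong: sum.cong_simp)
qed (use a_sym in auto)

section \<open>The Gaussian barrier and Hopf's argument\<close>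

lemma gaussian_derivatives:
  fixes y :: "'e::euclidean_space" and \<alpha> :: real
  defines "h \<equiv> \<lambda>x. exp (- \<alpha> * ((x - y) \<bullet> (x - y)))"
  shows "((\<lambda>x. h x - C) has_derivative (\<lambda>v. - 2 * \<alpha> * ((x - y) \<bullet> v) * h x)) (at x)"
    and "((\<lambda>x. - 2 * \<alpha> * ((x - y) \<bullet> v) * h x) has_derivative
      (\<lambda>i. (4 * \<alpha>\<^sup>2 * ((x - y) \<bullet> v) * ((x - y) \<bullet> i) - 2 * \<alpha> * (i \<bullet> v)) * h x)) (at x)"
  unfolding h_def
  by (auto intro!: derivative_eq_intros simp: inner_commute algebra_simps power2_eq_square)

text \<open>Hopf's argument: the set where \<open>u\<close> is smaller than its maximum contains a ball which
  touches the maximum set in a single point, and a Gaussian barrier on this ball, added to \<open>u\<close>,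
  produces an interior maximum at which the operator is positive.\<close>

lemma strong_maximum_principle:
  fixes u :: "'e::euclidean_space \<Rightarrow> real" and a :: "'e \<Rightarrow> 'e \<Rightarrow> 'e \<Rightarrow> real"
  assumes S: "open S" and smooth: "smooth_on S u"
    and a_cont: "\<And>i j. i \<in> Basis \<Longrightarrow> j \<in> Basis \<Longrightarrow> continuous_on S (a i j)"
    and b_cont: "\<And>i. i \<in> Basis \<Longrightarrow> continuous_on S (b i)"
    and a_sym: "\<And>i j x. i \<in> Basis \<Longrightarrow> j \<in> Basis \<Longrightarrow> x \<in> S \<Longrightarrow> a i j x = a j i x"
    and a_pos: "\<And>\<xi> x. x \<in> S \<Longrightarrow> \<xi> \<noteq> 0 \<Longrightarrow>
      0 < (\<Sum>i\<in>Basis. \<Sum>j\<in>Basis. a i j x * (\<xi> \<bullet> i) * (\<xi> \<bullet> j))"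
    and sub: "\<And>x. x \<in> S \<Longrightarrow> 0 \<le> (\<Sum>i\<in>Basis. \<Sum>j\<in>Basis. a i j x * dir_deriv (dir_deriv u j) i x)
      + (\<Sum>i\<in>Basis. b i x * dir_deriv u i x)"
    and p: "p \<in> S" and max: "\<And>x. x \<in> S \<Longrightarrow> u x \<le> u p"
  shows "\<exists>r>0. \<forall>x\<in>ball p r. u x = u p"
proof -
  have u_cont: "continuous_on S u"
    using smooth by (rule smooth_on_continuous)
  obtain r0 where r0: "r0 > 0" "cball p r0 \<subseteq> S"
    using S p open_contains_cball by blast
  \<comment> \<open>Half the radius leaves room: a point of the maximum set nearest to
    \<open>y\<close> is at most as far from \<open>y\<close> as \<open>p\<close> is, hence lies
    inside the larger ball.\<close>
  define r where "r = r0 / 2"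
  have r: "0 < r" "cball p (2 * r) \<subseteq> S"
    using r0 by (auto simp: r_def)
  have "u y = u p" if y: "y \<in> ball p r" for y
  proof (rule ccontr)
    assume ney: "u y \<noteq> u p"
    define Z where "Z = {x \<in> cball p (2 * r). u x = u p}"
    have "closed Z"
      unfolding Z_def
      by (intro continuous_closed_preimage_constant continuous_on_subset[OF u_cont]) (use r in auto)
    moreover have "p \<in> Z"
      using r by (simp add: Z_def)
    ultimately obtain z where z: "z \<in> Z" and near: "\<And>x. x \<in> Z \<Longrightarrow> dist y z \<le> dist y x"
      using distance_attains_inf[of Z y] by blast
    \<comment> \<open>The ball about the midpoint of \<open>y\<close> and \<open>z\<close> lies
      inside the ball about \<open>y\<close> through \<open>z\<close> and meets its sphere at
      \<open>z\<close> alone. Passing to this smaller ball makes the point of contact with the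
      maximum set unique.\<close>
    define R where "R = dist y z / 2"
    define c where "c = midpoint y z"
    have yz: "dist y z < r"
      using near[OF \<open>p \<in> Z\<close>] y by (simp add: dist_commute)
    have "y \<noteq> z"
      using z ney by (auto simp: Z_def)
    then have R: "0 < R" "2 * R < r" "dist c z = R"
      using yz by (auto simp: R_def c_def dist_midpoint)
    have less: "u x < u p" if "dist c x \<le> R" "x \<noteq> z" for x
    proof -
      \<comment> \<open>Parallelogram law, \<open>c\<close> being the midpoint of \<open>y\<close>
        and \<open>z\<close>.\<close>
      have "(dist y x)\<^sup>2 + (dist z x)\<^sup>2 = 2 * (dist c x)\<^sup>2 + 2 * R\<^sup>2"
      proof -
        define w n where "w = x - c" and "n = z - c"
        have e: "z = c + n" "x = c + w" "y = c - n"
          by (auto simp: w_def n_def c_def midpoint_def algebra_simps simp flip: scaleR_add_left)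
        have "R\<^sup>2 = n \<bullet> n"
          using R(3) by (simp add: n_def dist_norm norm_minus_commute dot_square_norm)
        then show ?thesis
          by (simp add: e dist_norm power2_norm_eq_inner algebra_simps inner_commute)
      qed
      moreover have "(dist c x)\<^sup>2 \<le> R\<^sup>2" "0 < (dist z x)\<^sup>2"
        using that by (auto simp: power_mono)
      moreover have "(2 * R)\<^sup>2 = 4 * R\<^sup>2"
        by simp
      ultimately have "(dist y x)\<^sup>2 < (2 * R)\<^sup>2"
        by linarith
      then have "dist y x < dist y z"
        using R by (simp add: R_def power2_less_imp_less)
      moreover from this have "dist p x \<le> 2 * r"
        using dist_triangle[of p x y] y yz by simp
      moreover from this have "u x \<le> u p"
        using r by (intro max) auto
      ultimately show ?thesis
        using near[of x] by (force simp: Z_def)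
    qed
    \<comment> \<open>The centre is removed so that x - c does not vanish on \<open>K\<close>, which
      gives \<open>Q\<close> below a positive minimum there.\<close>
    have "z \<in> ball p (2 * r) - {c}"
      using dist_triangle[of p z y] y yz R by auto
    moreover have "open (ball p (2 * r) - {c})"
      by auto
    ultimately obtain \<delta> where \<delta>: "0 < \<delta>" "cball z \<delta> \<subseteq> ball p (2 * r) - {c}"
      using open_contains_cball by blast
    define K where "K = cball z \<delta>"
    have "K \<subseteq> S"
      using \<delta>(2) r(2) ball_subset_cball unfolding K_def by fast
    then have K: "compact K" "K \<noteq> {}" "K \<subseteq> S" "c \<notin> K" "z \<in> K"
      using \<delta> by (auto simp: K_def)
    \<comment> \<open>On the Gaussian \<open>E\<close> below the operator yields E * (4 \<alpha>^2 Q
      - 2 \<alpha> T): \<open>Q\<close> collects the part of order \<alpha>^2, and \<open>T\<close>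
      the trace of \<open>a\<close> together with the first order terms.\<close>
    define Q where "Q x = (\<Sum>i\<in>Basis. \<Sum>j\<in>Basis. a i j x * ((x - c) \<bullet> i) * ((x - c) \<bullet> j))" for x
    define T where "T x = (\<Sum>i\<in>Basis. \<Sum>j\<in>Basis. a i j x * (i \<bullet> j)) + (\<Sum>i\<in>Basis. b i x * ((x - c) \<bullet> i))"
      for x
    have "continuous_on K Q"
      unfolding Q_def using K by (auto intro!: continuous_intros continuous_on_subset[OF a_cont])
    then obtain x0 where x0: "x0 \<in> K" "\<And>x. x \<in> K \<Longrightarrow> Q x0 \<le> Q x"
      using continuous_attains_inf[OF K(1,2)] by blast
    have q: "0 < Q x0"
      unfolding Q_def using K x0 by (intro a_pos) auto
    have "continuous_on K T"
      unfolding T_def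
      using K by (auto intro!: continuous_intros continuous_on_subset[OF a_cont] continuous_on_subset[OF b_cont])
    then obtain x1 where x1: "x1 \<in> K" "\<And>x. x \<in> K \<Longrightarrow> T x \<le> T x1"
      using continuous_attains_sup[OF K(1,2)] by blast
    \<comment> \<open>Large enough that \<alpha> Q > T on all of \<open>K\<close>, so the quadratic
      part of the barrier wins.\<close>
    define \<alpha> where "\<alpha> = (\<bar>T x1\<bar> + 1) / Q x0"
    have \<alpha>: "0 < \<alpha>" "\<alpha> * Q x0 = \<bar>T x1\<bar> + 1"
      using q by (auto simp: \<alpha>_def)
    define E where "E x = exp (- \<alpha> * ((x - c) \<bullet> (x - c)))" for x
    \<comment> \<open>Shifted to vanish on the sphere of radius \<open>R\<close> about
      \<open>c\<close>: positive inside, negative outside, zero at the point of contact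
      \<open>z\<close>.\<close>
    define h where "h x = E x - exp (- \<alpha> * R\<^sup>2)" for x
    have h_pos: "0 < 4 * \<alpha>\<^sup>2 * Q x - 2 * \<alpha> * T x" if "x \<in> K" for x
    proof -
      have "\<alpha> * Q x0 \<le> \<alpha> * Q x" "T x \<le> T x1"
        using mult_left_mono[OF x0(2)[OF that], of \<alpha>] \<alpha>(1) x1(2)[OF that] by auto
      then have "T x < 2 * (\<alpha> * Q x)"
        using \<alpha>(2) by linarith
      then have "0 < 2 * \<alpha> * (2 * (\<alpha> * Q x) - T x)"
        using \<alpha> by simp
      then show ?thesis
        by (simp add: algebra_simps power2_eq_square)
    qed
    \<comment> \<open>The part of the boundary of \<open>K\<close> inside the closed touching ball
      is compact and misses \<open>z\<close>, so \<open>u\<close> stays below its maximum by a gap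
      there. As h < 1, adding \<eta> h cannot bridge the gap. If that part is empty, any positive
      \<eta> works.\<close>
    obtain \<eta> where \<eta>: "0 < \<eta>" "\<And>x. x \<in> sphere z \<delta> \<inter> cball c R \<Longrightarrow> u x \<le> u p - \<eta>"
    proof (cases "sphere z \<delta> \<inter> cball c R = {}")
      case True
      then show ?thesis
        using that[of 1] by auto
    next
      case False
      have "continuous_on (sphere z \<delta> \<inter> cball c R) u"
        using K by (intro continuous_on_subset[OF u_cont]) (auto simp: K_def)
      then obtain x2 where x2: "x2 \<in> sphere z \<delta> \<inter> cball c R"
          "\<And>x. x \<in> sphere z \<delta> \<inter> cball c R \<Longrightarrow> u x \<le> u x2"
        using continuous_attains_sup[OF _ False] by (meson compact_Int compact_cball compact_sphere)
      have "u x2 < u p"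
        using x2(1) \<delta> by (intro less) auto
      then show ?thesis
        using that[of "u p - u x2"] x2 by auto
    qed
    define v where "v x = u x + \<eta> * h x" for x
    have "continuous_on K v"
      unfolding v_def h_def E_def using K
      by (auto intro!: continuous_intros continuous_on_subset[OF u_cont])
    then obtain w where w: "w \<in> K" "\<And>x. x \<in> K \<Longrightarrow> v x \<le> v w"
      using continuous_attains_sup[OF K(1,2)] by blast
    have EE: "E x = exp (- \<alpha> * (dist c x)\<^sup>2)" for x
      by (simp add: E_def dist_norm power2_norm_eq_inner[symmetric] norm_minus_commute)
    have "v z = u p"
      using z R by (simp add: v_def h_def EE Z_def)
    then have vw: "u p \<le> v w"
      using w(2)[OF K(5)] by simp
    \<comment> \<open>On the boundary of \<open>K\<close>, the gap keeps \<open>v\<close> below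
      \<open>u p\<close> within the touching ball, and the negative barrier does so outside it; but
      \<open>v\<close> takes the value \<open>u p\<close> at \<open>z\<close>. Hence its maximum
      over \<open>K\<close> is interior.\<close>
    have "w \<notin> sphere z \<delta>"
    proof
      assume ws: "w \<in> sphere z \<delta>"
      show False
      proof (cases "dist c w \<le> R")
        case True
        have "E w \<le> 1"
          using \<alpha> by (simp add: EE)
        then have "h w < 1"
          using exp_gt_zero[of "- \<alpha> * R\<^sup>2"] unfolding h_def by linarith
        then have "\<eta> * h w < \<eta> * 1"
          using \<eta>(1) by (intro mult_strict_left_mono)
        then show False
          using \<eta>(2)[of w] vw ws True by (simp add: v_def)
      next
        case False
        then have "R\<^sup>2 < (dist c w)\<^sup>2"
          using R by (intro power_strict_mono) auto
        then have "h w < 0"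
          using \<alpha> by (simp add: h_def EE)
        then have "\<eta> * h w < 0"
          using \<eta>(1) by (simp add: mult_pos_neg)
        then show False
          using max[of w] vw w K by (auto simp: v_def)
      qed
    qed
    then have wb: "w \<in> ball z \<delta>"
      using w by (auto simp: K_def)
    have sub_ball: "ball z \<delta> \<subseteq> S"
      using K(3) ball_subset_cball unfolding K_def by blast
    define v1 where "v1 \<xi> x = dir_deriv u \<xi> x + \<eta> * (- 2 * \<alpha> * ((x - c) \<bullet> \<xi>) * E x)" for \<xi> x
    define v2 where "v2 \<xi> i = dir_deriv (dir_deriv u \<xi>) i w
      + \<eta> * ((4 * \<alpha>\<^sup>2 * ((w - c) \<bullet> \<xi>) * ((w - c) \<bullet> i) - 2 * \<alpha> * (i \<bullet> \<xi>)) * E w)" for \<xi> i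
    have v1: "(v has_derivative (\<lambda>\<xi>. v1 \<xi> x)) (at x)" if "x \<in> ball z \<delta>" for x
      unfolding v_def v1_def h_def E_def
      using that sub_ball
      by (intro has_derivative_add has_derivative_mult_right gaussian_derivatives
          smooth_on_has_derivative[OF smooth]) auto
    have v2: "(v1 \<xi> has_derivative v2 \<xi>) (at w)" for \<xi>
      unfolding v1_def v2_def E_def
      using wb sub_ball
      by (intro has_derivative_add has_derivative_mult_right gaussian_derivatives
          smooth_on_has_derivative[OF smooth_on_dir_deriv[OF smooth]]) auto
    have vmax: "v x \<le> v w" if "x \<in> ball z \<delta>" for x
      using that w by (auto simp: K_def)
    have wS: "w \<in> S"
      using wb sub_ball by auto
    have "(\<Sum>i\<in>Basis. \<Sum>j\<in>Basis. a i j w * v2 j i) \<le> 0"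
      by (rule elliptic_at_max[OF open_ball wb v1 v2 vmax]) (use wS a_sym a_pos in auto)
    moreover have "v1 i w = 0" for i
      by (rule critical_point_at_max[OF open_ball wb v1[OF wb] vmax])
    ultimately have "(\<Sum>i\<in>Basis. \<Sum>j\<in>Basis. a i j w * v2 j i) + (\<Sum>i\<in>Basis. b i w * v1 i w) \<le> 0"
      by simp
    also have "(\<Sum>i\<in>Basis. \<Sum>j\<in>Basis. a i j w * v2 j i) + (\<Sum>i\<in>Basis. b i w * v1 i w)
      = (\<Sum>i\<in>Basis. \<Sum>j\<in>Basis. a i j w * dir_deriv (dir_deriv u j) i w)
        + (\<Sum>i\<in>Basis. b i w * dir_deriv u i w)
        + \<eta> * E w * (4 * \<alpha>\<^sup>2 * Q w - 2 * \<alpha> * T w)"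
      unfolding v1_def v2_def Q_def T_def
      by (simp add: algebra_simps sum.distrib sum_subtractf sum_distrib_left)
    finally have "(\<Sum>i\<in>Basis. \<Sum>j\<in>Basis. a i j w * dir_deriv (dir_deriv u j) i w)
        + (\<Sum>i\<in>Basis. b i w * dir_deriv u i w)
        + \<eta> * E w * (4 * \<alpha>\<^sup>2 * Q w - 2 * \<alpha> * T w) \<le> 0" .
    moreover have "0 < \<eta> * E w * (4 * \<alpha>\<^sup>2 * Q w - 2 * \<alpha> * T w)"
      using \<eta>(1) h_pos[OF w(1)] by (intro mult_pos_pos) (simp_all add: E_def)
    ultimately show False
      using sub[OF wS] by linarith
  qed
  then show ?thesis
    using r by blast
qed

section \<open>Riemannian metrics on open sets\<close>

lemma pos_form_unique:
  fixes b :: "'e::euclidean_space \<Rightarrow> 'e \<Rightarrow> real"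
  assumes b: "bilinear b" and pos: "\<And>u. u \<noteq> 0 \<Longrightarrow> 0 < b u u" and "\<And>w. b z w = b z' w"
  shows "z = z'"
proof (rule ccontr)
  assume "z \<noteq> z'"
  then have "0 < b (z - z') (z - z')"
    by (intro pos) simp
  then show False
    using assms(3)[of "z - z'"] unfolding bilinear_lsub[OF b] by simp
qed

text \<open>Riesz representation for the form \<open>b\<close>: lowering an index is a linear map
  \<open>L\<close>, injective by definiteness and hence surjective in finite dimension.\<close>

lemma pos_form_represents:
  fixes b :: "'e::euclidean_space \<Rightarrow> 'e \<Rightarrow> real"
  assumes b: "bilinear b" and pos: "\<And>u. u \<noteq> 0 \<Longrightarrow> 0 < b u u" and \<alpha>: "linear \<alpha>"
  shows "\<exists>!z. \<forall>w. b z w = \<alpha> w"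
proof -
  define L where "L z = (\<Sum>i\<in>Basis. b z i *\<^sub>R i)" for z
  have lin1: "linear (\<lambda>z. b z w)" and lin2: "linear (b z)" for z w
    using b by (auto simp: bilinear_def)
  have L: "L z \<bullet> w = b z w" for z w
    unfolding L_def linear_basis_sum[OF lin2, of z w]
    by (simp add: inner_sum_left) (simp add: inner_commute mult.commute)
  have "linear L"
    by (rule linearI) (auto simp: L_def linear_add[OF lin1] linear_cmul[OF lin1] sum.distrib
        scaleR_add_left scaleR_sum_right)
  moreover have "inj L"
    by (rule injI) (metis L pos_form_unique[OF b pos])
  ultimately have "surj L"
    using linear_injective_imp_surjective by blast
  then obtain z where "L z = (\<Sum>i\<in>Basis. \<alpha> i *\<^sub>R i)"
    by (metis surj_def)
  then have "b z w = \<alpha> w" for w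
    unfolding linear_basis_sum[OF \<alpha>, of w] L[symmetric]
    by (simp add: inner_sum_left) (simp add: inner_commute mult.commute)
  then show ?thesis
    by (intro ex1I[of _ z] allI pos_form_unique[OF b pos]) auto
qed

text \<open>\<open>raise g x i\<close> is the gradient of the linear function \<open>(\<bullet>) i\<close>, so that \<open>raise g x i \<bullet> j\<close> are
  the entries of the inverse metric.\<close>

definition raise :: "('e::euclidean_space \<Rightarrow> 'e \<Rightarrow> 'e \<Rightarrow> real) \<Rightarrow> 'e \<Rightarrow> 'e \<Rightarrow> 'e" where
  "raise g x i = (THE z. \<forall>w. g x z w = i \<bullet> w)"

text \<open>An explicit sum rather than a definite description, so that its derivative reduces to
  those of \<open>dir_deriv u i\<close> and of \<open>raise\<close>.\<close>

definition grad :: "('e::euclidean_space \<Rightarrow> 'e \<Rightarrow> 'e \<Rightarrow> real) \<Rightarrow> ('e \<Rightarrow> real) \<Rightarrow> 'e \<Rightarrow> 'e" where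
  "grad g u x = (\<Sum>i\<in>Basis. dir_deriv u i x *\<^sub>R raise g x i)"

definition divergence :: "('e::euclidean_space \<Rightarrow> 'e \<Rightarrow> 'e \<Rightarrow> real) \<Rightarrow> ('e \<Rightarrow> 'e) \<Rightarrow> 'e \<Rightarrow> real" where
  "divergence g Y x = (\<Sum>e\<in>Basis. cov_deriv g e Y x \<bullet> e)"

definition koszul :: "('e::euclidean_space \<Rightarrow> 'e \<Rightarrow> 'e \<Rightarrow> real) \<Rightarrow> 'e \<Rightarrow> 'e \<Rightarrow> 'e \<Rightarrow> 'e \<Rightarrow> real" where
  "koszul g x u v w =
     dir_deriv (\<lambda>y. g y v w) u x + dir_deriv (\<lambda>y. g y u w) v x - dir_deriv (\<lambda>y. g y u v) w x"

text \<open>The metric is constrained at the point \<open>x\<close> only, so this also serves for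
  the warped metric, whose Christoffel symbols are guessed and then checked against the Koszul
  formula.\<close>

lemma christoffel_eqI:
  assumes "bilinear (g x)" "\<And>u. u \<noteq> 0 \<Longrightarrow> 0 < g x u u" "\<And>w. 2 * g x z w = koszul g x u v w"
  shows "christoffel g x u v = z"
  unfolding christoffel_def koszul_def[symmetric]
proof (rule the_equality)
  show "\<forall>w. 2 * g x z w = koszul g x u v w"
    using assms(3) by blast
  show "z' = z" if "\<forall>w. 2 * g x z' w = koszul g x u v w" for z'
  proof (rule pos_form_unique[OF assms(1,2)])
    show "g x z' w = g x z w" for w
      using that assms(3)[of w] by (metis mult_left_cancel zero_neq_numeral)
  qed
qed

text \<open>The expression of a metric in one chart, on the open coordinate image \<open>S\<close>.
  Values outside \<open>S\<close> are arbitrary, so identities pass under a derivative by openness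
  of \<open>S\<close>.\<close>

locale local_metric =
  fixes S :: "'e::euclidean_space set" and g :: "'e \<Rightarrow> 'e \<Rightarrow> 'e \<Rightarrow> real"
  assumes open_S: "open S"
    and bilin: "x \<in> S \<Longrightarrow> bilinear (g x)"
    and sym: "x \<in> S \<Longrightarrow> g x u v = g x v u"
    and pos: "x \<in> S \<Longrightarrow> u \<noteq> 0 \<Longrightarrow> 0 < g x u u"
    and smooth: "smooth_on S (\<lambda>x. g x u v)"
begin

lemma linear_left: "x \<in> S \<Longrightarrow> linear (\<lambda>u. g x u v)"
  and linear_right: "x \<in> S \<Longrightarrow> linear (g x u)"
  using bilin by (auto simp: bilinear_def)

lemma raise:
  assumes "x \<in> S"
  shows "g x (raise g x i) w = i \<bullet> w"
proof -
  have "\<exists>!z. \<forall>w. g x z w = i \<bullet> w"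
    using bilin[OF assms] pos[OF assms]
    by (rule pos_form_represents) (auto intro: bounded_linear.linear bounded_linear_inner_right)
  from theI'[OF this] show ?thesis
    by (simp add: raise_def)
qed

text \<open>Raises the index of an arbitrary covector \<alpha>. Differentials become gradients, the
  Koszul expression becomes the Christoffel symbol, and the contracted derivative of the metric
  becomes the derivative of its inverse.\<close>

lemma raise_sum:
  assumes "x \<in> S" "linear \<alpha>"
  shows "g x (\<Sum>i\<in>Basis. \<alpha> i *\<^sub>R raise g x i) w = \<alpha> w"
  unfolding linear_basis_sum[OF assms(2), of w]
  by (simp add: linear_sum[OF linear_left[OF assms(1)]] linear_cmul[OF linear_left[OF assms(1)]]
      raise[OF assms(1)] inner_commute mult.commute)

lemma linear_dir_deriv:
  assumes "smooth_on S h" "x \<in> S"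
  shows "linear (\<lambda>v. dir_deriv h v x)"
  using smooth_on_has_derivative[OF assms] by (simp add: has_derivative_def bounded_linear.linear)

lemma grad:
  assumes "x \<in> S" "smooth_on S u"
  shows "g x (grad g u x) w = dir_deriv u w x"
  unfolding grad_def by (rule raise_sum[OF assms(1) linear_dir_deriv[OF assms(2,1)]])

lemma has_derivative_metric:
  "x \<in> S \<Longrightarrow> ((\<lambda>x. g x u v) has_derivative (\<lambda>w. dir_deriv (\<lambda>x. g x u v) w x)) (at x)"
  by (rule smooth_on_has_derivative[OF smooth])

lemma dir_deriv_metric_add:
  assumes "x \<in> S"
  shows "dir_deriv (\<lambda>y. g y (u + u') v) w x = dir_deriv (\<lambda>y. g y u v) w x + dir_deriv (\<lambda>y. g y u' v) w x"
    and "dir_deriv (\<lambda>y. g y v (u + u')) w x = dir_deriv (\<lambda>y. g y v u) w x + dir_deriv (\<lambda>y. g y v u') w x"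
proof -
  have "((\<lambda>y. g y (u + u') v) has_derivative
      (\<lambda>w. dir_deriv (\<lambda>y. g y u v) w x + dir_deriv (\<lambda>y. g y u' v) w x)) (at x)"
    using has_derivative_add[OF has_derivative_metric has_derivative_metric, OF assms assms] assms
    by (rule has_derivative_transform_within_open[OF _ open_S]) (auto simp: bilinear_ladd[OF bilin])
  then show "dir_deriv (\<lambda>y. g y (u + u') v) w x
      = dir_deriv (\<lambda>y. g y u v) w x + dir_deriv (\<lambda>y. g y u' v) w x"
    by (rule dir_deriv_eq)
  have "((\<lambda>y. g y v (u + u')) has_derivative
      (\<lambda>w. dir_deriv (\<lambda>y. g y v u) w x + dir_deriv (\<lambda>y. g y v u') w x)) (at x)"
    using has_derivative_add[OF has_derivative_metric has_derivative_metric, OF assms assms] assms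
    by (rule has_derivative_transform_within_open[OF _ open_S]) (auto simp: bilinear_radd[OF bilin])
  then show "dir_deriv (\<lambda>y. g y v (u + u')) w x
      = dir_deriv (\<lambda>y. g y v u) w x + dir_deriv (\<lambda>y. g y v u') w x"
    by (rule dir_deriv_eq)
qed

lemma dir_deriv_metric_cmul:
  assumes "x \<in> S"
  shows "dir_deriv (\<lambda>y. g y (c *\<^sub>R u) v) w x = c * dir_deriv (\<lambda>y. g y u v) w x"
    and "dir_deriv (\<lambda>y. g y v (c *\<^sub>R u)) w x = c * dir_deriv (\<lambda>y. g y v u) w x"
proof -
  have "((\<lambda>y. g y (c *\<^sub>R u) v) has_derivative (\<lambda>w. c * dir_deriv (\<lambda>y. g y u v) w x)) (at x)"
    using has_derivative_mult_right[OF has_derivative_metric[OF assms]] assms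
    by (rule has_derivative_transform_within_open[OF _ open_S]) (auto simp: bilinear_lmul[OF bilin])
  then show "dir_deriv (\<lambda>y. g y (c *\<^sub>R u) v) w x = c * dir_deriv (\<lambda>y. g y u v) w x"
    by (rule dir_deriv_eq)
  have "((\<lambda>y. g y v (c *\<^sub>R u)) has_derivative (\<lambda>w. c * dir_deriv (\<lambda>y. g y v u) w x)) (at x)"
    using has_derivative_mult_right[OF has_derivative_metric[OF assms]] assms
    by (rule has_derivative_transform_within_open[OF _ open_S]) (auto simp: bilinear_rmul[OF bilin])
  then show "dir_deriv (\<lambda>y. g y v (c *\<^sub>R u)) w x = c * dir_deriv (\<lambda>y. g y v u) w x"
    by (rule dir_deriv_eq)
qed

lemmas dir_deriv_metric_linear = dir_deriv_metric_add dir_deriv_metric_cmul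
  linear_add[OF linear_dir_deriv[OF smooth]] linear_cmul[OF linear_dir_deriv[OF smooth]]

lemma linear_koszul:
  assumes "x \<in> S"
  shows "linear (\<lambda>w. koszul g x u v w / 2)"
  by (rule linearI)
    (auto simp: koszul_def dir_deriv_metric_linear[OF assms] algebra_simps add_divide_distrib diff_divide_distrib)

text \<open>Replaces the definite description by a sum of products, from which continuity and
  differentiability can be read off.\<close>

lemma christoffel_eq:
  assumes "x \<in> S"
  shows "christoffel g x u v = (\<Sum>j\<in>Basis. (koszul g x u v j / 2) *\<^sub>R raise g x j)"
proof (rule christoffel_eqI)
  fix w
  from raise_sum[OF assms linear_koszul[OF assms], of u v w]
  show "2 * g x (\<Sum>j\<in>Basis. (koszul g x u v j / 2) *\<^sub>R raise g x j) w = koszul g x u v w"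
    by simp
qed (use bilin pos assms in auto)

lemma christoffel:
  assumes "x \<in> S"
  shows "2 * g x (christoffel g x u v) w = koszul g x u v w"
  using raise_sum[OF assms linear_koszul[OF assms], of u v w] by (simp add: christoffel_eq[OF assms])

lemma linear_christoffel:
  assumes "x \<in> S"
  shows "linear (christoffel g x u)" "linear (\<lambda>u. christoffel g x u v)"
  by (rule linearI; simp add: christoffel_eq[OF assms] koszul_def dir_deriv_metric_linear[OF assms]
      scaleR_sum_right flip: sum.distrib scaleR_add_left;
      simp add: algebra_simps add_divide_distrib diff_divide_distrib)+

section \<open>Differentiability of the inverse metric\<close>

lemma metric_eq_sum:
  assumes "x \<in> S"
  shows "g x u v = (\<Sum>k\<in>Basis. (u \<bullet> k) * g x k v)"
  using linear_basis_sum[OF linear_left[OF assms], of u v] by simp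

text \<open>The constant is the minimum over a closed ball times the unit sphere, and homogeneity
  extends the bound to all vectors. It lets the components of g x d control the norm of d.\<close>

lemma locally_coercive:
  assumes "x0 \<in> S"
  obtains c r where "0 < c" "0 < r" "ball x0 r \<subseteq> S"
    "\<And>x u. x \<in> ball x0 r \<Longrightarrow> c * (norm u)\<^sup>2 \<le> g x u u"
proof -
  obtain r where r: "0 < r" "cball x0 r \<subseteq> S"
    using open_S assms open_contains_cball by blast
  define K where "K = cball x0 r \<times> sphere (0::'e) 1"
  \<comment> \<open>Smoothness is given for fixed vector arguments; expanding in the basis yields
    continuity jointly in the point and the vector.\<close>
  have gK: "g x u u = (\<Sum>k\<in>Basis. \<Sum>j\<in>Basis. (u \<bullet> k) * (u \<bullet> j) * g x k j)" if "x \<in> S" for x u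
  proof -
    have "g x u u = (\<Sum>k\<in>Basis. (u \<bullet> k) * g x k u)"
      by (rule metric_eq_sum[OF that])
    also have "\<dots> = (\<Sum>k\<in>Basis. (u \<bullet> k) * (\<Sum>j\<in>Basis. (u \<bullet> j) * g x k j))"
      by (intro sum.cong refl arg_cong2[where f="(*)"] linear_basis_sum[OF linear_right[OF that], simplified])
    finally show ?thesis
      by (simp add: sum_distrib_left mult_ac)
  qed
  have cont: "continuous_on K (\<lambda>z. g (fst z) k j)" for k j
    by (rule continuous_on_compose2[OF smooth_on_continuous[OF smooth]])
      (use r in \<open>auto simp: K_def intro: continuous_intros\<close>)
  have "continuous_on K (\<lambda>z. \<Sum>k\<in>Basis. \<Sum>j\<in>Basis. (snd z \<bullet> k) * (snd z \<bullet> j) * g (fst z) k j)"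
    by (intro continuous_intros cont)
  then have "continuous_on K (\<lambda>z. g (fst z) (snd z) (snd z))"
  proof (rule continuous_on_eq)
    fix z assume "z \<in> K"
    then have "fst z \<in> S"
      using r by (auto simp: K_def)
    from gK[OF this, symmetric] show "(\<Sum>k\<in>Basis. \<Sum>j\<in>Basis. (snd z \<bullet> k) * (snd z \<bullet> j) * g (fst z) k j)
        = g (fst z) (snd z) (snd z)" .
  qed
  moreover have "compact K"
    unfolding K_def by (intro compact_Times compact_cball compact_sphere)
  moreover obtain e :: 'e where "norm e = 1"
    using vector_choose_size[of 1] by auto
  then have "K \<noteq> {}"
    using r by (auto simp: K_def)
  ultimately obtain z where z: "z \<in> K" "\<And>y. y \<in> K \<Longrightarrow> g (fst z) (snd z) (snd z) \<le> g (fst y) (snd y) (snd y)"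
    using continuous_attains_inf[of K "\<lambda>z. g (fst z) (snd z) (snd z)"] by blast
  define c where "c = g (fst z) (snd z) (snd z)"
  have "0 < c"
    unfolding c_def using z(1) r by (intro pos) (auto simp: K_def)
  moreover have "c * (norm u)\<^sup>2 \<le> g x u u" if x: "x \<in> ball x0 r" for x u
  proof (cases "u = 0")
    case True
    have "x \<in> S"
      using x r by auto
    then show ?thesis
      using True by (simp add: bilinear_lzero[OF bilin])
  next
    case False
    have "x \<in> S"
      using x r by auto
    define v where "v = u /\<^sub>R norm u"
    have "c \<le> g x v v"
      unfolding c_def using z(2)[of "(x, v)"] x False by (simp add: K_def v_def)
    then have "c * (norm u)\<^sup>2 \<le> (norm u)\<^sup>2 * g x v v"
      unfolding mult.commute[of c] by (intro mult_left_mono) auto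
    also have "\<dots> = g x u u"
      using False by (simp add: v_def bilinear_lmul[OF bilin[OF \<open>x \<in> S\<close>]]
          bilinear_rmul[OF bilin[OF \<open>x \<in> S\<close>]] power2_eq_square field_simps)
    finally show ?thesis .
  qed
  ultimately show ?thesis
    using that[of c r] r by force
qed

text \<open>This is the derivative of an inverse matrix, -(g^-1)(dg)(g^-1). The remainder
  \<open>d\<close> of the linear approximation has components g x (d x) b in which
  \<open>raise\<close> enters only through its defining identity, so they are differentiable at
  \<open>x0\<close>. They vanish there to first order, and coercivity passes this on to
  \<open>d\<close>.\<close>

lemma raise_has_derivative:
  assumes x0: "x0 \<in> S"
  shows "((\<lambda>x. raise g x i) has_derivative
    (\<lambda>h. - (\<Sum>j\<in>Basis. (\<Sum>k\<in>Basis. (raise g x0 i \<bullet> k) * dir_deriv (\<lambda>y. g y k j) h x0) *\<^sub>R raise g x0 j)))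
    (at x0)" (is "(_ has_derivative ?D) _")
proof -
  obtain c r where c: "0 < c" and r: "0 < r" "ball x0 r \<subseteq> S"
    and coercive: "\<And>x u. x \<in> ball x0 r \<Longrightarrow> c * (norm u)\<^sup>2 \<le> g x u u"
    using locally_coercive[OF x0] by blast
  define z where "z = raise g x0 i"
  have "linear ?D"
    by (rule linearI)
      (simp_all add: dir_deriv_metric_linear[OF x0] scaleR_add_left sum.distrib sum_distrib_left
        scaleR_sum_right ring_distribs mult_ac flip: sum_negf)
  then have bl: "bounded_linear ?D"
    by (rule linear_conv_bounded_linear[THEN iffD1])
  define d where "d x = raise g x i - z - ?D (x - x0)" for x
  define \<psi> where "\<psi> b x = i \<bullet> b - (\<Sum>k\<in>Basis. (z \<bullet> k) * g x k b)
    - (\<Sum>k\<in>Basis. (?D (x - x0) \<bullet> k) * g x k b)" for b x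
  have \<psi>_eq: "g x (d x) b = \<psi> b x" if "x \<in> S" for x b
  proof -
    have "g x (d x) b = g x (raise g x i) b - g x z b - g x (?D (x - x0)) b"
      by (simp only: d_def bilinear_lsub[OF bilin[OF that]])
    then show ?thesis
      by (simp only: \<psi>_def raise[OF that] metric_eq_sum[OF that, of z] metric_eq_sum[OF that, of "?D _"])
  qed
  have \<psi>0: "\<psi> b x0 = 0" for b
    using \<psi>_eq[OF x0, of b] linear_0[OF \<open>linear ?D\<close>]
    by (simp add: d_def z_def bilinear_lzero[OF bilin[OF x0]])
  have D: "((\<lambda>x. ?D (x - x0)) has_derivative ?D) (at x0)"
    by (rule bounded_linear.has_derivative[OF bl]) (auto intro!: derivative_eq_intros)
  have \<psi>_der: "(\<psi> b has_derivative (\<lambda>h. 0)) (at x0)" if b: "b \<in> Basis" for b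
  proof -
    \<comment> \<open>\<open>?D\<close> is the negated derivative of the metric, contracted with
      \<open>z\<close> and with its index raised; this choice makes the derivative of \<psi>
      vanish.\<close>
    have "g x0 (?D h) b = - (\<Sum>k\<in>Basis. (z \<bullet> k) * dir_deriv (\<lambda>y. g y k b) h x0)" for h
    proof -
      have "linear (\<lambda>j. \<Sum>k\<in>Basis. (z \<bullet> k) * dir_deriv (\<lambda>y. g y k j) h x0)"
        by (rule linearI) (simp_all add: dir_deriv_metric_linear[OF x0] ring_distribs sum.distrib sum_distrib_left mult_ac)
      from raise_sum[OF x0 this, of b] show ?thesis
        by (simp add: z_def bilinear_lneg[OF bilin[OF x0]])
    qed
    then have zero: "(\<Sum>k\<in>Basis. (?D h \<bullet> k) * g x0 k b) = - (\<Sum>k\<in>Basis. (z \<bullet> k) * dir_deriv (\<lambda>y. g y k b) h x0)" for h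
      by (simp only: metric_eq_sum[OF x0, symmetric])
    have D0: "?D (x0 - x0) = 0"
      using linear_0[OF \<open>linear ?D\<close>] by simp
    have "((\<lambda>x. (?D (x - x0) \<bullet> k) * g x k b) has_derivative (\<lambda>h. (?D h \<bullet> k) * g x0 k b)) (at x0)" for k
      using has_derivative_mult[OF has_derivative_inner_left[OF D] has_derivative_metric[OF x0], of k k b]
      unfolding D0 by simp
    from has_derivative_diff[OF has_derivative_diff[OF has_derivative_const
        has_derivative_sum[OF has_derivative_mult_right[OF has_derivative_metric[OF x0]]]]
        has_derivative_sum[OF this]]
    have "(\<psi> b has_derivative (\<lambda>h. 0 - (\<Sum>k\<in>Basis. (z \<bullet> k) * dir_deriv (\<lambda>y. g y k b) h x0)
      - (\<Sum>k\<in>Basis. (?D h \<bullet> k) * g x0 k b))) (at x0)"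
      unfolding \<psi>_def .
    then show ?thesis
      unfolding zero by simp
  qed
  have bound: "norm (d x) \<le> (\<Sum>b\<in>Basis. \<bar>\<psi> b x\<bar>) / c" if x: "x \<in> ball x0 r" for x
  proof -
    have xS: "x \<in> S"
      using x r by auto
    have "c * (norm (d x))\<^sup>2 \<le> g x (d x) (d x)"
      by (rule coercive[OF x])
    also have "\<dots> = (\<Sum>b\<in>Basis. (d x \<bullet> b) * \<psi> b x)"
      using linear_basis_sum[OF linear_right[OF xS], of "d x" "d x"] by (simp add: \<psi>_eq[OF xS])
    also have "\<dots> \<le> (\<Sum>b\<in>Basis. norm (d x) * \<bar>\<psi> b x\<bar>)"
    proof (rule sum_mono)
      fix b :: 'e assume "b \<in> Basis"
      then show "(d x \<bullet> b) * \<psi> b x \<le> norm (d x) * \<bar>\<psi> b x\<bar>"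
        using mult_right_mono[OF Basis_le_norm[of b "d x"], of "\<bar>\<psi> b x\<bar>"] abs_ge_self[of "(d x \<bullet> b) * \<psi> b x"]
        by (simp add: abs_mult)
    qed
    finally have "norm (d x) * (c * norm (d x)) \<le> norm (d x) * (\<Sum>b\<in>Basis. \<bar>\<psi> b x\<bar>)"
      by (simp add: sum_distrib_left power2_eq_square mult_ac)
    then have "c * norm (d x) \<le> (\<Sum>b\<in>Basis. \<bar>\<psi> b x\<bar>)"
      by (cases "d x = 0") (auto simp: sum_nonneg)
    then show ?thesis
      using c by (simp add: field_simps)
  qed
  have "((\<lambda>x. (\<Sum>b\<in>Basis. \<bar>\<psi> b x\<bar> / norm (x - x0)) / c) \<longlongrightarrow> (\<Sum>b\<in>(Basis::'e set). 0) / c) (at x0)"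
    using \<psi>_der c by (intro tendsto_intros) (auto simp: has_derivative_iff_norm \<psi>0)
  then have lim: "((\<lambda>x. (\<Sum>b\<in>Basis. \<bar>\<psi> b x\<bar> / norm (x - x0)) / c) \<longlongrightarrow> 0) (at x0)"
    by simp
  have "((\<lambda>x. norm (d x) / norm (x - x0)) \<longlongrightarrow> 0) (at x0)"
  proof (rule Lim_null_comparison[OF _ lim])
    show "\<forall>\<^sub>F x in at x0. norm (norm (d x) / norm (x - x0)) \<le> (\<Sum>b\<in>Basis. \<bar>\<psi> b x\<bar> / norm (x - x0)) / c"
      using eventually_at_ball[OF r(1)]
    proof eventually_elim
      case (elim x)
      from divide_right_mono[OF bound[OF elim[THEN conjunct1]], of "norm (x - x0)"] show ?case
        by (simp add: sum_divide_distrib mult.commute)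
    qed
  qed
  then show ?thesis
    using bl by (simp add: has_derivative_iff_norm d_def z_def)
qed

lemma dir_deriv_raise:
  assumes "x \<in> S"
  shows "dir_deriv (\<lambda>x. raise g x i) h x
    = - (\<Sum>j\<in>Basis. (\<Sum>k\<in>Basis. (raise g x i \<bullet> k) * dir_deriv (\<lambda>y. g y k j) h x) *\<^sub>R raise g x j)"
  by (rule dir_deriv_eq[OF raise_has_derivative[OF assms]])

lemma continuous_raise: "continuous_on S (\<lambda>x. raise g x i)"
  using raise_has_derivative
  by (meson continuous_at_imp_continuous_on has_derivative_continuous)

lemma continuous_dir_deriv_metric: "continuous_on S (dir_deriv (\<lambda>y. g y u v) w)"
  by (intro smooth_on_continuous smooth_on_dir_deriv smooth)

lemma continuous_christoffel: "continuous_on S (\<lambda>x. christoffel g x u v)"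
proof -
  have "continuous_on S (\<lambda>x. \<Sum>j\<in>Basis. (koszul g x u v j / 2) *\<^sub>R raise g x j)"
    unfolding koszul_def
    by (intro continuous_intros continuous_raise continuous_dir_deriv_metric)
      (auto simp: continuous_dir_deriv_metric)
  then show ?thesis
    by (rule continuous_on_eq) (simp add: christoffel_eq)
qed

text \<open>The Laplacian of the coordinate function \<open>(\<bullet>) i\<close>.\<close>

abbreviation "drift i x \<equiv> divergence g (\<lambda>x. raise g x i) x"

lemma continuous_drift: "continuous_on S (drift i)"
proof -
  have "continuous_on S (\<lambda>x. \<Sum>e\<in>Basis.
    (- (\<Sum>j\<in>Basis. (\<Sum>k\<in>Basis. (raise g x i \<bullet> k) * dir_deriv (\<lambda>y. g y k j) e x) *\<^sub>R raise g x j)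
      + (\<Sum>k\<in>Basis. (raise g x i \<bullet> k) *\<^sub>R christoffel g x e k)) \<bullet> e)"
    by (intro continuous_intros continuous_raise continuous_christoffel)
      (auto intro: continuous_dir_deriv_metric)
  then show ?thesis
    by (rule continuous_on_eq)
      (simp add: divergence_def cov_deriv_def dir_deriv_raise
        linear_basis_sum[OF linear_christoffel(1), of _ _ "raise g _ _"])
qed

section \<open>The Laplacian as an elliptic operator\<close>

lemma inverse_metric_sym:
  assumes "x \<in> S"
  shows "raise g x i \<bullet> j = raise g x j \<bullet> i"
  using raise[OF assms, of j "raise g x i"] raise[OF assms, of i "raise g x j"] sym[OF assms]
  by (simp add: inner_commute)

text \<open>Raising the index of \<xi> gives a vector \<open>R\<close> for which the double sum, the
  inner product of \<xi> and \<open>R\<close>, equals g(R,R).\<close>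

lemma inverse_metric_pos:
  assumes "x \<in> S" "\<xi> \<noteq> 0"
  shows "0 < (\<Sum>i\<in>Basis. \<Sum>j\<in>Basis. (raise g x j \<bullet> i) * (\<xi> \<bullet> i) * (\<xi> \<bullet> j))"
proof -
  define R where "R = (\<Sum>j\<in>Basis. (\<xi> \<bullet> j) *\<^sub>R raise g x j)"
  have R: "g x R w = \<xi> \<bullet> w" for w
    unfolding R_def using assms
    by (intro raise_sum) (auto intro: bounded_linear.linear bounded_linear_inner_right)
  have "R \<noteq> 0"
    using R[of \<xi>] assms by (auto simp: bilinear_lzero[OF bilin])
  then have "0 < \<xi> \<bullet> R"
    using R pos[OF assms(1)] by metis
  also have "\<dots> = (\<Sum>i\<in>Basis. (\<xi> \<bullet> i) * (R \<bullet> i))"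
    by (rule euclidean_inner)
  also have "\<dots> = (\<Sum>i\<in>Basis. \<Sum>j\<in>Basis. (raise g x j \<bullet> i) * (\<xi> \<bullet> i) * (\<xi> \<bullet> j))"
    by (simp add: R_def inner_sum_left sum_distrib_left mult_ac)
  finally show ?thesis .
qed

lemma grad_has_derivative:
  assumes "x \<in> S" "smooth_on S u"
  shows "(grad g u has_derivative (\<lambda>h. \<Sum>i\<in>Basis. dir_deriv u i x *\<^sub>R dir_deriv (\<lambda>x. raise g x i) h x
    + dir_deriv (dir_deriv u i) h x *\<^sub>R raise g x i)) (at x)"
proof -
  have "((\<lambda>x. dir_deriv u i x *\<^sub>R raise g x i) has_derivative
      (\<lambda>h. dir_deriv u i x *\<^sub>R dir_deriv (\<lambda>x. raise g x i) h x
    + dir_deriv (dir_deriv u i) h x *\<^sub>R raise g x i)) (at x)" for i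
    unfolding dir_deriv_raise[OF assms(1)]
    by (rule has_derivative_scaleR[OF smooth_on_has_derivative[OF smooth_on_dir_deriv[OF assms(2)] assms(1)]
          raise_has_derivative[OF assms(1)]])
  from has_derivative_sum[OF this] show ?thesis
    unfolding grad_def[abs_def] .
qed

text \<open>The gradient is a sum of partial derivatives of \<open>u\<close> times gradients of
  coordinates. By the product rule the second derivatives of \<open>u\<close> meet the inverse
  metric, and what is left are the Laplacians of the coordinates.\<close>

lemma laplacian_eq:
  assumes x: "x \<in> S" and u: "smooth_on S u"
  shows "divergence g (grad g u) x =
    (\<Sum>i\<in>Basis. \<Sum>j\<in>Basis. (raise g x j \<bullet> i) * dir_deriv (dir_deriv u j) i x)
    + (\<Sum>j\<in>Basis. drift j x * dir_deriv u j x)"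
proof -
  have "dir_deriv (grad g u) e x = (\<Sum>i\<in>Basis. dir_deriv u i x *\<^sub>R dir_deriv (\<lambda>x. raise g x i) e x
    + dir_deriv (dir_deriv u i) e x *\<^sub>R raise g x i)" for e
    by (rule dir_deriv_eq[OF grad_has_derivative[OF assms]])
  moreover have "christoffel g x e (grad g u x) = (\<Sum>j\<in>Basis. dir_deriv u j x *\<^sub>R christoffel g x e (raise g x j))" for e
    by (simp add: grad_def linear_sum[OF linear_christoffel(1)[OF x]] linear_cmul[OF linear_christoffel(1)[OF x]])
  ultimately have "divergence g (grad g u) x =
    (\<Sum>i\<in>Basis. \<Sum>j\<in>Basis. (raise g x j \<bullet> i) * dir_deriv (dir_deriv u j) i x)
    + (\<Sum>i\<in>Basis. \<Sum>j\<in>Basis. (cov_deriv g i (\<lambda>x. raise g x j) x \<bullet> i) * dir_deriv u j x)"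
    unfolding divergence_def cov_deriv_def
    by (simp add: inner_sum_left inner_add_left sum.distrib algebra_simps)
  also have "(\<Sum>i\<in>Basis. \<Sum>j\<in>Basis. (cov_deriv g i (\<lambda>x. raise g x j) x \<bullet> i) * dir_deriv u j x)
    = (\<Sum>j\<in>Basis. drift j x * dir_deriv u j x)"
    unfolding divergence_def by (subst sum.swap) (simp add: sum_distrib_right)
  finally show ?thesis .
qed

text \<open>At a critical point the drift is multiplied by zero, so only the principal part
  remains.\<close>

lemma laplacian_at_max:
  assumes x: "x \<in> S" and u: "smooth_on S u" and max: "\<And>y. y \<in> S \<Longrightarrow> u y \<le> u x"
  shows "dir_deriv u v x = 0" "divergence g (grad g u) x \<le> 0"
proof -
  show crit: "dir_deriv u v x = 0" for v
    by (rule critical_point_at_max[OF open_S x smooth_on_has_derivative[OF u x] max])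
  show "divergence g (grad g u) x \<le> 0"
    unfolding laplacian_eq[OF x u] crit
    using elliptic_at_max[OF open_S x smooth_on_has_derivative[OF u]
        smooth_on_has_derivative[OF smooth_on_dir_deriv[OF u] x] max,
        where a="\<lambda>i j. raise g x j \<bullet> i"]
      inverse_metric_sym[OF x] inverse_metric_pos[OF x]
    by simp
qed

text \<open>As \<open>elliptic_at_max\<close> takes derivatives as data, it is fed the negated
  derivatives of \<open>u\<close>.\<close>

lemma laplacian_at_min:
  assumes x: "x \<in> S" and u: "smooth_on S u" and min: "\<And>y. y \<in> S \<Longrightarrow> u x \<le> u y"
  shows "dir_deriv u v x = 0" "0 \<le> divergence g (grad g u) x"
proof -
  have u1: "((\<lambda>x. - u x) has_derivative (\<lambda>v. - dir_deriv u v y)) (at y)" if "y \<in> S" for y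
    by (rule has_derivative_minus[OF smooth_on_has_derivative[OF u that]])
  have u2: "((\<lambda>x. - dir_deriv u v x) has_derivative (\<lambda>w. - dir_deriv (dir_deriv u v) w x)) (at x)" for v
    by (rule has_derivative_minus[OF smooth_on_has_derivative[OF smooth_on_dir_deriv[OF u] x]])
  have max: "- u y \<le> - u x" if "y \<in> S" for y
    using min that by simp
  show crit: "dir_deriv u v x = 0" for v
    using critical_point_at_max[OF open_S x u1[OF x] max, of v] by simp
  show "0 \<le> divergence g (grad g u) x"
    unfolding laplacian_eq[OF x u] crit
    using elliptic_at_max[OF open_S x u1 u2 max, where a="\<lambda>i j. raise g x j \<bullet> i"]
      inverse_metric_sym[OF x] inverse_metric_pos[OF x]
    by (simp add: sum_negf)
qed

lemma continuous_dir_deriv_raise: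
  assumes "smooth_on S u"
  shows "continuous_on S (\<lambda>x. dir_deriv u (raise g x i) x)"
proof -
  have "continuous_on S (dir_deriv u k)" for k
    by (intro smooth_on_continuous smooth_on_dir_deriv assms)
  then have "continuous_on S (\<lambda>x. \<Sum>k\<in>Basis. (raise g x i \<bullet> k) *\<^sub>R dir_deriv u k x)"
    by (intro continuous_intros continuous_raise)
  then show ?thesis
    by (rule continuous_on_eq) (rule linear_basis_sum[OF linear_dir_deriv[OF assms], symmetric])
qed

lemma dir_deriv_grad:
  assumes "x \<in> S" "smooth_on S h"
  shows "dir_deriv h (grad g u x) x = (\<Sum>i\<in>Basis. dir_deriv u i x * dir_deriv h (raise g x i) x)"
proof -
  note lin = linear_dir_deriv[OF assms(2,1)]
  show ?thesis
    unfolding grad_def linear_sum[OF lin] linear_cmul[OF lin] by simp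
qed

text \<open>Although the equation is quadratic in \<open>u\<close>, it is linear in the derivatives of \<open>u\<close> once the
  gradient terms are absorbed into the drift.\<close>

lemma strong_maximum_laplacian:
  assumes u: "smooth_on S u" and \<phi>: "smooth_on S \<phi>"
    and u_pos: "\<And>x. x \<in> S \<Longrightarrow> 0 < u x"
    and eq: "\<And>x. x \<in> S \<Longrightarrow> u x * divergence g (grad g u) x + c * dir_deriv u (grad g u x) x
      - u x * dir_deriv \<phi> (grad g u x) x = 0"
    and p: "p \<in> S" and max: "\<And>x. x \<in> S \<Longrightarrow> u x \<le> u p"
  shows "\<exists>r>0. \<forall>x\<in>ball p r. u x = u p"
proof -
  \<comment> \<open>The coefficient of \<open>dir_deriv u i x\<close> once the equation is divided
    by u > 0 and \<open>grad g u x\<close> is expanded in the vectors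
    \<open>raise g x i\<close>.\<close>
  define b where "b i x = drift i x + c * dir_deriv u (raise g x i) x / u x - dir_deriv \<phi> (raise g x i) x" for i x
  show ?thesis
  proof (rule strong_maximum_principle[OF open_S u _ _ _ _ _ p max, where a="\<lambda>i j x. raise g x j \<bullet> i" and b=b])
    show "continuous_on S (\<lambda>x. raise g x j \<bullet> i)" for i j
      by (intro continuous_intros continuous_raise)
    show "continuous_on S (b i)" for i
      unfolding b_def using u_pos
      by (intro continuous_intros continuous_drift continuous_dir_deriv_raise u \<phi> smooth_on_continuous) force
    show "raise g x j \<bullet> i = raise g x i \<bullet> j" if "x \<in> S" for i j x
      by (rule inverse_metric_sym[OF that])
    show "0 < (\<Sum>i\<in>Basis. \<Sum>j\<in>Basis. (raise g x j \<bullet> i) * (\<xi> \<bullet> i) * (\<xi> \<bullet> j))" if "x \<in> S" "\<xi> \<noteq> 0" for x \<xi>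
      by (rule inverse_metric_pos[OF that])
    fix x assume x: "x \<in> S"
    define A where "A = (\<Sum>i\<in>Basis. \<Sum>j\<in>Basis. (raise g x j \<bullet> i) * dir_deriv (dir_deriv u j) i x)"
    have b: "(\<Sum>i\<in>Basis. b i x * dir_deriv u i x) = (\<Sum>i\<in>Basis. drift i x * dir_deriv u i x)
      + c * dir_deriv u (grad g u x) x / u x - dir_deriv \<phi> (grad g u x) x"
      by (simp add: b_def dir_deriv_grad[OF x] u \<phi> algebra_simps sum.distrib sum_subtractf
          sum_distrib_left sum_divide_distrib)
    have "u x * (A + (\<Sum>i\<in>Basis. b i x * dir_deriv u i x))
      = u x * (A + (\<Sum>i\<in>Basis. drift i x * dir_deriv u i x)) + c * dir_deriv u (grad g u x) x
        - u x * dir_deriv \<phi> (grad g u x) x"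
      unfolding b using u_pos[OF x] by (simp add: algebra_simps)
    then have "u x * (A + (\<Sum>i\<in>Basis. b i x * dir_deriv u i x)) = 0"
      using eq[OF x] u_pos[OF x] unfolding laplacian_eq[OF x u] A_def[symmetric] by (simp add: algebra_simps)
    then show "0 \<le> A + (\<Sum>i\<in>Basis. b i x * dir_deriv u i x)"
      using u_pos[OF x] by simp
  qed
qed

text \<open>The curvature of the fibre differentiates these symbols; the explicit sum is
  differentiable because the inverse metric is.\<close>

lemma has_derivative_christoffel:
  assumes "x \<in> S"
  shows "((\<lambda>x. christoffel g x u v) has_derivative (\<lambda>h. dir_deriv (\<lambda>x. christoffel g x u v) h x)) (at x)"
proof -
  have "dir_deriv (\<lambda>y. g y u v) w differentiable (at x)" for u v w
    by (rule smooth_on_differentiable[OF smooth_on_dir_deriv[OF smooth] assms])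
  then have "(\<lambda>x. koszul g x u v j / 2) differentiable (at x)" for j
    unfolding koszul_def by (intro differentiable_divide differentiable_add differentiable_diff) auto
  then have "(\<lambda>x. (koszul g x u v j / 2) *\<^sub>R raise g x j) differentiable (at x)" for j
    using differentiable_scaleR differentiableI[OF raise_has_derivative[OF assms]] by blast
  then have "(\<lambda>x. \<Sum>j\<in>Basis. (koszul g x u v j / 2) *\<^sub>R raise g x j) differentiable (at x)"
    by (intro differentiable_sum) auto
  then obtain D where "((\<lambda>x. \<Sum>j\<in>Basis. (koszul g x u v j / 2) *\<^sub>R raise g x j) has_derivative D) (at x)"
    by (auto simp: differentiable_def)
  then have "((\<lambda>x. christoffel g x u v) has_derivative D) (at x)"
    by (rule has_derivative_transform_within_open[OF _ open_S assms]) (simp add: christoffel_eq)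
  then show ?thesis
    by (intro has_derivative_dir_deriv differentiableI)
qed

end

section \<open>Warped products of open sets\<close>

lemma sum_Basis_prod:
  "(\<Sum>e\<in>Basis. F e) = (\<Sum>e\<in>Basis. F (e, 0)) + (\<Sum>e\<in>Basis. F (0, e))"
  for F :: "'a::euclidean_space \<times> 'b::euclidean_space \<Rightarrow> real"
proof -
  have "inj_on (\<lambda>u. (u::'a, 0::'b)) Basis" "inj_on (\<lambda>v. (0::'a, v::'b)) Basis"
    by (auto intro!: inj_onI)
  then show ?thesis
    unfolding Basis_prod_def by (subst sum.union_disjoint) (auto simp: sum.reindex)
qed

lemma cov_deriv_const: "cov_deriv G u (\<lambda>_. w) x = christoffel G x u w"
  using dir_deriv_eq[OF has_derivative_const, of w u x] by (simp add: cov_deriv_def)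

text \<open>\<open>G\<close> and \<psi> are prescribed on S x T only, since the coordinate
  expressions they stand for take arbitrary values elsewhere. The two factors and \<open>f\<close>
  supply all regularity.\<close>

locale local_warped_product = base: local_metric S g + fib: local_metric T k
  for S :: "'a::euclidean_space set" and g and T :: "'b::euclidean_space set" and k +
  fixes f \<phi> :: "'a \<Rightarrow> real" and G :: "'a \<times> 'b \<Rightarrow> 'a \<times> 'b \<Rightarrow> 'a \<times> 'b \<Rightarrow> real"
    and \<psi> :: "'a \<times> 'b \<Rightarrow> real"
  assumes f_smooth: "smooth_on S f" and f_pos: "x \<in> S \<Longrightarrow> 0 < f x"
    and \<phi>_smooth: "smooth_on S \<phi>"
    and G: "x \<in> S \<Longrightarrow> y \<in> T \<Longrightarrow> G (x, y) U V = g x (fst U) (fst V) + (f x)\<^sup>2 * k y (snd U) (snd V)"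
    and \<psi>: "x \<in> S \<Longrightarrow> y \<in> T \<Longrightarrow> \<psi> (x, y) = \<phi> x"
begin

lemma open_product: "open (S \<times> T)"
  by (intro open_Times base.open_S fib.open_S)

lemma has_derivative_base:
  "(h has_derivative h') (at x) \<Longrightarrow> ((\<lambda>z. h (fst z)) has_derivative (\<lambda>v. h' (fst v))) (at (x, y))"
  using has_derivative_compose[OF has_derivative_fst[OF has_derivative_ident], of h h' "(x, y)" UNIV] by simp

lemma has_derivative_fiber:
  "(h has_derivative h') (at y) \<Longrightarrow> ((\<lambda>z. h (snd z)) has_derivative (\<lambda>v. h' (snd v))) (at (x, y))"
  using has_derivative_compose[OF has_derivative_snd[OF has_derivative_ident], of h h' "(x, y)" UNIV] by simp

lemma dir_deriv_base_zero: "x \<in> S \<Longrightarrow> dir_deriv f 0 x = 0"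
  using linear_0[OF base.linear_dir_deriv[OF f_smooth]] .

lemma dir_deriv_warped:
  assumes "x \<in> S" "y \<in> T"
  shows "dir_deriv (\<lambda>z. G z U V) W (x, y) =
    dir_deriv (\<lambda>x. g x (fst U) (fst V)) (fst W) x
    + 2 * f x * dir_deriv f (fst W) x * k y (snd U) (snd V)
    + (f x)\<^sup>2 * dir_deriv (\<lambda>y. k y (snd U) (snd V)) (snd W) y"
proof -
  note D = has_derivative_base[OF base.has_derivative_metric[OF assms(1)]]
    has_derivative_fiber[OF fib.has_derivative_metric[OF assms(2)]]
    has_derivative_base[OF smooth_on_has_derivative[OF f_smooth assms(1)]]
  have "((\<lambda>z. g (fst z) (fst U) (fst V) + (f (fst z))\<^sup>2 * k (snd z) (snd U) (snd V)) has_derivative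
    (\<lambda>W. dir_deriv (\<lambda>x. g x (fst U) (fst V)) (fst W) x
    + 2 * f x * dir_deriv f (fst W) x * k y (snd U) (snd V)
    + (f x)\<^sup>2 * dir_deriv (\<lambda>y. k y (snd U) (snd V)) (snd W) y)) (at (x, y))"
    by (rule derivative_eq_intros D refl)+ (auto simp: algebra_simps)
  then have "((\<lambda>z. G z U V) has_derivative
    (\<lambda>W. dir_deriv (\<lambda>x. g x (fst U) (fst V)) (fst W) x
    + 2 * f x * dir_deriv f (fst W) x * k y (snd U) (snd V)
    + (f x)\<^sup>2 * dir_deriv (\<lambda>y. k y (snd U) (snd V)) (snd W) y)) (at (x, y))"
    by (rule has_derivative_transform_within_open[OF _ open_product]) (use assms in \<open>auto simp: G\<close>)
  then show ?thesis
    by (rule dir_deriv_eq)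
qed

lemma bilinear_warped:
  assumes "x \<in> S" "y \<in> T"
  shows "bilinear (G (x, y))"
  unfolding bilinear_def
  by (intro conjI allI linearI)
    (simp_all add: G assms bilinear_ladd[OF base.bilin] bilinear_ladd[OF fib.bilin]
      bilinear_radd[OF base.bilin] bilinear_radd[OF fib.bilin]
      bilinear_lmul[OF base.bilin] bilinear_lmul[OF fib.bilin]
      bilinear_rmul[OF base.bilin] bilinear_rmul[OF fib.bilin] algebra_simps)

lemma warped_pos:
  assumes "x \<in> S" "y \<in> T" "U \<noteq> 0"
  shows "0 < G (x, y) U U"
proof -
  have "0 \<le> g x u u" "0 \<le> k y v v" for u v
    using base.pos[OF assms(1), of u] fib.pos[OF assms(2), of v]
      bilinear_lzero[OF base.bilin[OF assms(1)]] bilinear_lzero[OF fib.bilin[OF assms(2)]]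
    by (cases "u = 0"; cases "v = 0"; force)+
  moreover have "0 < g x (fst U) (fst U) \<or> 0 < k y (snd U) (snd U)"
    using assms base.pos fib.pos by (metis prod_eq_iff fst_zero snd_zero)
  ultimately show ?thesis
    using f_pos[OF assms(1)] by (auto simp: G assms add_pos_nonneg add_nonneg_pos)
qed

text \<open>The classical formulas: the fibres have second fundamental form -f k(v,w) grad f, and
  mixed directions contribute df/f. The candidate is inserted into the Koszul formula, where the
  factor f^2 of the fibre metric absorbs the quotients by \<open>f\<close>.\<close>

lemma christoffel_warped:
  assumes "x \<in> S" "y \<in> T"
  shows "christoffel G (x, y) U V =
    (christoffel g x (fst U) (fst V) - (f x * k y (snd U) (snd V)) *\<^sub>R grad g f x,
     christoffel k y (snd U) (snd V) + (dir_deriv f (fst U) x / f x) *\<^sub>R snd V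
       + (dir_deriv f (fst V) x / f x) *\<^sub>R snd U)"
proof (rule christoffel_eqI[of G "(x, y)", OF bilinear_warped[OF assms] warped_pos[OF assms]])
  fix W :: "'a \<times> 'b"
  note lin = bilinear_lsub[OF base.bilin[OF assms(1)]] bilinear_lmul[OF base.bilin[OF assms(1)]]
    bilinear_ladd[OF fib.bilin[OF assms(2)]] bilinear_lmul[OF fib.bilin[OF assms(2)]]
  have ring: "(f x)\<^sup>2 * (a / f x * p) = f x * a * p" for a p
    using f_pos[OF assms(1)] by (simp add: power2_eq_square)
  have id: "2 * (A - f x * q * D + (f x)\<^sup>2 * (C + a / f x * p + b / f x * r))
      = 2 * A + (f x)\<^sup>2 * (2 * C) - 2 * f x * D * q + 2 * f x * a * p + 2 * f x * b * r" for A C D a b p q r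
    unfolding distrib_left[of "(f x)\<^sup>2"] ring by (simp add: algebra_simps)
  have "G (x, y)
    (christoffel g x (fst U) (fst V) - (f x * k y (snd U) (snd V)) *\<^sub>R grad g f x,
     christoffel k y (snd U) (snd V) + (dir_deriv f (fst U) x / f x) *\<^sub>R snd V
       + (dir_deriv f (fst V) x / f x) *\<^sub>R snd U) W =
    g x (christoffel g x (fst U) (fst V)) (fst W) - f x * k y (snd U) (snd V) * dir_deriv f (fst W) x
    + (f x)\<^sup>2 * (k y (christoffel k y (snd U) (snd V)) (snd W)
      + dir_deriv f (fst U) x / f x * k y (snd V) (snd W) + dir_deriv f (fst V) x / f x * k y (snd U) (snd W))"
    by (simp only: G[OF assms] fst_conv snd_conv lin base.grad[OF assms(1) f_smooth] real_scaleR_def)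
  then have "2 * G (x, y)
    (christoffel g x (fst U) (fst V) - (f x * k y (snd U) (snd V)) *\<^sub>R grad g f x,
     christoffel k y (snd U) (snd V) + (dir_deriv f (fst U) x / f x) *\<^sub>R snd V
       + (dir_deriv f (fst V) x / f x) *\<^sub>R snd U) W
    = koszul g x (fst U) (fst V) (fst W) + (f x)\<^sup>2 * koszul k y (snd U) (snd V) (snd W)
      - 2 * f x * dir_deriv f (fst W) x * k y (snd U) (snd V)
      + 2 * f x * dir_deriv f (fst U) x * k y (snd V) (snd W)
      + 2 * f x * dir_deriv f (fst V) x * k y (snd U) (snd W)"
    by (simp only: id base.christoffel[OF assms(1)] fib.christoffel[OF assms(2)])
  also have "\<dots> = koszul G (x, y) U V W"
    unfolding koszul_def dir_deriv_warped[OF assms] by (simp add: algebra_simps)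
  finally show "2 * G (x, y)
    (christoffel g x (fst U) (fst V) - (f x * k y (snd U) (snd V)) *\<^sub>R grad g f x,
     christoffel k y (snd U) (snd V) + (dir_deriv f (fst U) x / f x) *\<^sub>R snd V
       + (dir_deriv f (fst V) x / f x) *\<^sub>R snd U) W = koszul G (x, y) U V W" .
qed

lemma christoffel_vertical:
  assumes "x \<in> S" "y \<in> T"
  shows "christoffel G (x, y) (0, v) (0, w) = (- (f x * k y v w) *\<^sub>R grad g f x, christoffel k y v w)"
  using linear_0[OF base.linear_christoffel(1)[OF assms(1)]]
  by (simp add: christoffel_warped assms dir_deriv_base_zero)

lemma christoffel_mixed:
  assumes "x \<in> S" "y \<in> T"
  shows "christoffel G (x, y) (e, 0) (0, w) = (0, (dir_deriv f e x / f x) *\<^sub>R w)"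
  using linear_0[OF base.linear_christoffel(1)[OF assms(1)]]
    linear_0[OF fib.linear_christoffel(2)[OF assms(2)]]
  by (simp add: christoffel_warped assms dir_deriv_base_zero bilinear_lzero[OF fib.bilin])

section \<open>Curvature and Hessian in vertical directions\<close>

lemma dir_deriv_christoffel_vertical:
  assumes "x \<in> S" "y \<in> T"
  shows "dir_deriv (\<lambda>z. christoffel G z (0, v) (0, w)) (e, h) (x, y) =
    (- (dir_deriv f e x * k y v w + f x * dir_deriv (\<lambda>y. k y v w) h y) *\<^sub>R grad g f x
      - (f x * k y v w) *\<^sub>R dir_deriv (grad g f) e x,
     dir_deriv (\<lambda>y. christoffel k y v w) h y)"
proof -
  have grad: "(grad g f has_derivative (\<lambda>h. dir_deriv (grad g f) h x)) (at x)"
    by (rule has_derivative_dir_deriv[OF differentiableI[OF base.grad_has_derivative[OF assms(1) f_smooth]]])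
  note D = has_derivative_base[OF grad] has_derivative_fiber[OF fib.has_derivative_metric[OF assms(2)]]
    has_derivative_fiber[OF fib.has_derivative_christoffel[OF assms(2)]]
    has_derivative_base[OF smooth_on_has_derivative[OF f_smooth assms(1)]]
  have "((\<lambda>z. (- (f (fst z) * k (snd z) v w) *\<^sub>R grad g f (fst z), christoffel k (snd z) v w)) has_derivative
    (\<lambda>H. (- (dir_deriv f (fst H) x * k y v w + f x * dir_deriv (\<lambda>y. k y v w) (snd H) y) *\<^sub>R grad g f x
      - (f x * k y v w) *\<^sub>R dir_deriv (grad g f) (fst H) x,
     dir_deriv (\<lambda>y. christoffel k y v w) (snd H) y))) (at (x, y))"
    by (rule derivative_eq_intros D refl)+ (auto simp: algebra_simps)
  then have "((\<lambda>z. christoffel G z (0, v) (0, w)) has_derivative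
    (\<lambda>H. (- (dir_deriv f (fst H) x * k y v w + f x * dir_deriv (\<lambda>y. k y v w) (snd H) y) *\<^sub>R grad g f x
      - (f x * k y v w) *\<^sub>R dir_deriv (grad g f) (fst H) x,
     dir_deriv (\<lambda>y. christoffel k y v w) (snd H) y))) (at (x, y))"
    by (rule has_derivative_transform_within_open[OF _ open_product])
      (use assms in \<open>auto simp: christoffel_vertical\<close>)
  from dir_deriv_eq[OF this] show ?thesis
    by simp
qed

text \<open>The coefficient df(e)/f of the mixed symbol depends on the base point alone.\<close>

lemma dir_deriv_christoffel_mixed:
  assumes "x \<in> S" "y \<in> T"
  shows "dir_deriv (\<lambda>z. christoffel G z (e, 0) (0, w)) (0, h) (x, y) = 0"
proof -
  define q where "q x = dir_deriv f e x / f x" for x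
  have "q differentiable (at x)"
    unfolding q_def using f_pos[OF assms(1)]
    by (intro differentiable_divide smooth_on_differentiable[OF _ assms(1)] smooth_on_dir_deriv f_smooth) auto
  then obtain q' where q': "(q has_derivative q') (at x)"
    by (auto simp: differentiable_def)
  have "((\<lambda>z. (0, q (fst z) *\<^sub>R w)) has_derivative (\<lambda>H. (0, q' (fst H) *\<^sub>R w))) (at (x, y))"
    by (rule derivative_eq_intros has_derivative_base[OF q'] refl)+ simp
  then have "((\<lambda>z. christoffel G z (e, 0) (0, w)) has_derivative (\<lambda>H. (0, q' (fst H) *\<^sub>R w))) (at (x, y))"
    by (rule has_derivative_transform_within_open[OF _ open_product])
      (use assms in \<open>auto simp: christoffel_mixed q_def\<close>)
  from dir_deriv_eq[OF this] show ?thesis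
    using linear_0[OF has_derivative_linear[OF q']] by (simp add: zero_prod_def)
qed

text \<open>The Ricci trace pairs this curvature with (e, 0), which sees the base component; summed
  over \<open>e\<close> it turns the covariant derivative of grad f into the Laplacian.\<close>

lemma riemann_base_direction:
  assumes "x \<in> S" "y \<in> T"
  shows "fst (riemann G (x, y) (e, 0) (0, v) (0, w)) = - (f x * k y v w) *\<^sub>R cov_deriv g e (grad g f) x"
proof -
  have 1: "fst (christoffel G (x, y) (e, 0) (- (f x * k y v w) *\<^sub>R grad g f x, christoffel k y v w))
      = - (f x * k y v w) *\<^sub>R christoffel g x e (grad g f x)"
    using linear_cmul[OF base.linear_christoffel(1)[OF assms(1)], of e "- (f x * k y v w)" "grad g f x"]
    by (simp add: christoffel_warped assms bilinear_lzero[OF fib.bilin])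
  \<comment> \<open>This term, from the covariant derivative in the fibre direction, cancels the one
    that arises when the factor \<open>f\<close> of the vertical symbol is differentiated along
    \<open>e\<close>.\<close>
  have 2: "f x * k y v ((dir_deriv f e x / f x) *\<^sub>R w) = dir_deriv f e x * k y v w"
    using f_pos[OF assms(1)] by (simp add: bilinear_rmul[OF fib.bilin[OF assms(2)]])
  show ?thesis
    unfolding riemann_def cov_deriv_const[abs_def]
    unfolding cov_deriv_def christoffel_vertical[OF assms] christoffel_mixed[OF assms]
      dir_deriv_christoffel_vertical[OF assms] dir_deriv_christoffel_mixed[OF assms]
    by (simp only: fst_add fst_diff fst_conv fst_zero 1 2)
      (simp add: base.linear_dir_deriv linear_0[OF fib.linear_dir_deriv[OF fib.smooth]] assms algebra_simps)
qed

text \<open>A Gauss equation: the fibres are umbilic, so the correction has the shape of a constant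
  curvature tensor, with coefficient |grad f|^2, written as
  \<open>dir_deriv f (grad g f x) x\<close>.\<close>

lemma riemann_fiber_direction:
  assumes "x \<in> S" "y \<in> T"
  shows "snd (riemann G (x, y) (0, e) (0, v) (0, w)) = riemann k y e v w
    - dir_deriv f (grad g f x) x *\<^sub>R (k y v w *\<^sub>R e - k y e w *\<^sub>R v)"
proof -
  \<comment> \<open>The base part -f k grad f of the inner symbol comes back as a fibre vector: df/f
    applied to it gives -k |grad f|^2, and \<open>f\<close> cancels.\<close>
  have 1: "snd (christoffel G (x, y) (0, e) (- (f x * k y v w) *\<^sub>R grad g f x, u))
      = christoffel k y e u - (k y v w * dir_deriv f (grad g f x) x) *\<^sub>R e" for e v u
    using f_pos[OF assms(1)] linear_cmul[OF base.linear_dir_deriv[OF f_smooth assms(1)], of "- (f x * k y v w)" "grad g f x"]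
    by (simp add: christoffel_warped assms dir_deriv_base_zero)
  show ?thesis
    unfolding riemann_def cov_deriv_const[abs_def]
    unfolding cov_deriv_def christoffel_vertical[OF assms]
      dir_deriv_christoffel_vertical[OF assms]
    by (simp only: snd_add snd_diff snd_conv 1) (simp add: algebra_simps)
qed

text \<open>The horizontal half of the product basis traces to the Laplacian. In the vertical half
  the two terms of the Gauss correction trace to m and -1, whence the factor m - 1.\<close>

lemma ricci_vertical:
  assumes "x \<in> S" "y \<in> T"
  shows "ricci G (x, y) (0, v) (0, w) = ricci k y v w
    - k y v w * ((real DIM('b) - 1) * dir_deriv f (grad g f x) x + f x * divergence g (grad g f) x)"
proof -
  have base: "(\<Sum>e\<in>Basis. riemann G (x, y) (e, 0) (0, v) (0, w) \<bullet> (e, 0))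
      = - (f x * k y v w) * divergence g (grad g f) x"
    by (simp add: inner_prod_def riemann_base_direction[OF assms] divergence_def sum_distrib_left sum_negf)
  have kw: "(\<Sum>e\<in>Basis. k y e w * (v \<bullet> e)) = k y v w"
    by (simp add: fib.metric_eq_sum[OF assms(2), of v w] mult.commute)
  have "(\<Sum>e\<in>Basis. riemann G (x, y) (0, e) (0, v) (0, w) \<bullet> (0, e))
      = (\<Sum>e\<in>Basis. riemann k y e v w \<bullet> e - dir_deriv f (grad g f x) x * (k y v w - k y e w * (v \<bullet> e)))"
    by (intro sum.cong refl) (simp add: inner_prod_def riemann_fiber_direction[OF assms] inner_diff_left)
  also have "\<dots> = ricci k y v w - dir_deriv f (grad g f x) x * (real DIM('b) * k y v w - k y v w)"
    by (simp add: sum_subtractf kw ricci_def flip: sum_distrib_left)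
  finally show ?thesis
    unfolding ricci_def[of G] sum_Basis_prod base by (simp add: algebra_simps)
qed

text \<open>As \<psi> is constant along the fibres, its plain second derivative vanishes, and the
  contribution is that of the horizontal part -f k grad f of the Christoffel symbol.\<close>

lemma hessian_vertical:
  assumes "x \<in> S" "y \<in> T"
  shows "hessian G \<psi> (x, y) (0, v) (0, w) = f x * k y v w * dir_deriv \<phi> (grad g f x) x"
proof -
  have \<psi>_der: "(\<psi> has_derivative (\<lambda>H. dir_deriv \<phi> (fst H) x)) (at (x, y))" if "x \<in> S" "y \<in> T" for x y
    by (rule has_derivative_transform_within_open[OF
          has_derivative_base[OF smooth_on_has_derivative[OF \<phi>_smooth that(1)]] open_product])
      (use that in \<open>auto simp: \<psi>\<close>)
  have d: "dir_deriv \<psi> (a, b) (x, y) = dir_deriv \<phi> a x" if "x \<in> S" "y \<in> T" for x y a b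
    using dir_deriv_eq[OF \<psi>_der[OF that]] by simp
  have "(dir_deriv \<psi> (0, w) has_derivative (\<lambda>H. 0)) (at (x, y))"
    by (rule has_derivative_transform_within_open[OF has_derivative_const open_product])
      (use assms in \<open>auto simp: d linear_0[OF base.linear_dir_deriv[OF \<phi>_smooth]]\<close>)
  from dir_deriv_eq[OF this] show ?thesis
    using linear_cmul[OF base.linear_dir_deriv[OF \<phi>_smooth assms(1)], of "- (f x * k y v w)" "grad g f x"]
    by (simp add: hessian_def cov_deriv_const christoffel_vertical[OF assms] d[OF assms])
qed

lemma soliton_vertical:
  assumes "x \<in> S" "y \<in> T"
    and "ricci G (x, y) (0, v) (0, v) + hessian G \<psi> (x, y) (0, v) (0, v) = lam * G (x, y) (0, v) (0, v)"
  shows "ricci k y v v = k y v v * (lam * (f x)\<^sup>2 + f x * divergence g (grad g f) x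
    + (real DIM('b) - 1) * dir_deriv f (grad g f x) x - f x * dir_deriv \<phi> (grad g f x) x)"
  using assms(3) bilinear_lzero[OF base.bilin[OF assms(1)]]
  unfolding ricci_vertical[OF assms(1,2)] hessian_vertical[OF assms(1,2)] G[OF assms(1,2)]
  by (simp add: algebra_simps)

end

section \<open>Charts of warped products\<close>

lemma chart_inj:
  assumes "is_chart X c"
  shows "inj_on (coord c) (chart_dom c)"
proof -
  have "chart_dom c \<subseteq> topspace X"
    using assms by (simp add: is_chart_def openin_subset)
  then have "topspace (subtopology X (chart_dom c)) = chart_dom c"
    by auto
  then show ?thesis
    using assms unfolding is_chart_def by (metis homeomorphic_imp_injective_map)
qed

lemma uncoord_coord:
  assumes "is_chart X c" "p \<in> chart_dom c"
  shows "uncoord c (coord c p) = p"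
  unfolding uncoord_def by (rule inv_into_f_f[OF chart_inj[OF assms(1)] assms(2)])

lemma coord_uncoord: "x \<in> coord c ` chart_dom c \<Longrightarrow> coord c (uncoord c x) = x"
  unfolding uncoord_def by (rule f_inv_into_f)

lemma uncoord_in: "x \<in> coord c ` chart_dom c \<Longrightarrow> uncoord c x \<in> chart_dom c"
  unfolding uncoord_def by (rule inv_into_into)

lemma openin_chart_preimage:
  assumes "is_chart X c" "open V"
  shows "openin X {p \<in> chart_dom c. coord c p \<in> V}"
proof -
  have D: "openin X (chart_dom c)"
    using assms by (simp add: is_chart_def)
  have "homeomorphic_map (subtopology X (chart_dom c)) (top_of_set (coord c ` chart_dom c)) (coord c)"
    using assms(1) by (simp add: is_chart_def)
  then have "continuous_map (subtopology X (chart_dom c)) euclidean (coord c)"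
    by (rule continuous_map_into_fulltopology[OF homeomorphic_imp_continuous_map])
  from openin_continuous_map_preimage[OF this open_openin[THEN iffD1, OF assms(2)]]
  have "openin (subtopology X (chart_dom c)) {p \<in> topspace (subtopology X (chart_dom c)). coord c p \<in> V}" .
  then have "openin X {p \<in> topspace (subtopology X (chart_dom c)). coord c p \<in> V}"
    by (rule openin_trans_full[OF _ D])
  moreover have "topspace (subtopology X (chart_dom c)) = chart_dom c"
    using openin_subset[OF D] by (simp add: inf.absorb2)
  ultimately show ?thesis
    by (simp only:)
qed

lemma open_coord_image:
  assumes "is_chart X c" "openin X U"
  shows "open (coord c ` (chart_dom c \<inter> U))"
proof -
  have "open_map (subtopology X (chart_dom c)) (top_of_set (coord c ` chart_dom c)) (coord c)"
    using assms(1) by (simp add: is_chart_def homeomorphic_imp_open_map)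
  moreover have "openin (subtopology X (chart_dom c)) (chart_dom c \<inter> U)"
    using assms(2) by (auto simp: openin_subtopology)
  ultimately have "openin (top_of_set (coord c ` chart_dom c)) (coord c ` (chart_dom c \<inter> U))"
    by (simp add: open_map_def)
  then show ?thesis
    using assms(1) by (simp add: is_chart_def openin_open_eq)
qed

lemma is_chart_atlas: "smooth_manifold M \<Longrightarrow> c \<in> atlas M \<Longrightarrow> is_chart (topo M) c"
  and chart_dom_subset: "smooth_manifold M \<Longrightarrow> c \<in> atlas M \<Longrightarrow> chart_dom c \<subseteq> points M"
  and chart_at: "smooth_manifold M \<Longrightarrow> p \<in> points M \<Longrightarrow> \<exists>c\<in>atlas M. p \<in> chart_dom c"
  unfolding smooth_manifold_def by auto

lemma riemannian_metricD:
  assumes "riemannian_manifold M g" "c \<in> atlas M"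
  shows "p \<in> chart_dom c \<Longrightarrow> bilinear (g c p)"
    and "p \<in> chart_dom c \<Longrightarrow> g c p u v = g c p v u"
    and "p \<in> chart_dom c \<Longrightarrow> u \<noteq> 0 \<Longrightarrow> 0 < g c p u u"
    and "smooth_on (coord c ` chart_dom c) (\<lambda>x. g c (uncoord c x) u v)"
    and "d \<in> atlas M \<Longrightarrow> p \<in> chart_dom c \<Longrightarrow> p \<in> chart_dom d \<Longrightarrow>
      g c p u v = g d p (coord_diff c d id p u) (coord_diff c d id p v)"
  using assms unfolding riemannian_manifold_def riemannian_metric_def by blast+

lemma local_metric_chart:
  assumes "riemannian_manifold M g" "c \<in> atlas M"
  shows "local_metric (coord c ` chart_dom c) (in_coords g c)"
proof
  have "is_chart (topo M) c"
    using assms by (auto simp: riemannian_manifold_def intro: is_chart_atlas)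
  then show "open (coord c ` chart_dom c)"
    by (simp add: is_chart_def)
  show "smooth_on (coord c ` chart_dom c) (\<lambda>x. in_coords g c x u v)" for u v
    unfolding in_coords_def by (rule riemannian_metricD(4)[OF assms])
  fix x u v
  assume "x \<in> coord c ` chart_dom c"
  note D = riemannian_metricD(1-3)[OF assms uncoord_in[OF this], folded in_coords_def]
  show "bilinear (in_coords g c x)"
    by (rule D(1))
  show "in_coords g c x u v = in_coords g c x v u"
    by (rule D(2))
  show "u \<noteq> 0 \<Longrightarrow> 0 < in_coords g c x u u"
    by (rule D(3))
qed

section \<open>Product charts and pulled back metrics\<close>

lemma prod_chart_inj:
  assumes "is_chart X c" "is_chart Y d"
  shows "inj_on (map_prod (coord c) (coord d)) (chart_dom c \<times> chart_dom d)"
  by (rule map_prod_inj_on[OF chart_inj[OF assms(1)] chart_inj[OF assms(2)]])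

lemma uncoord_prod:
  assumes "is_chart X c" "is_chart Y d" "x \<in> coord c ` chart_dom c" "y \<in> coord d ` chart_dom d"
  shows "uncoord (chart_dom c \<times> chart_dom d, map_prod (coord c) (coord d)) (x, y) = (uncoord c x, uncoord d y)"
proof -
  have "inv_into (chart_dom c \<times> chart_dom d) (map_prod (coord c) (coord d))
    (map_prod (coord c) (coord d) (uncoord c x, uncoord d y)) = (uncoord c x, uncoord d y)"
    using assms(3,4) by (intro inv_into_f_f prod_chart_inj[OF assms(1,2)]) (simp add: uncoord_in)
  then show ?thesis
    using assms(3,4) by (simp add: uncoord_def[of "(_, _)"] coord_uncoord)
qed

lemma transition_has_derivative:
  assumes M: "smooth_manifold M" and c: "c \<in> atlas M" "c' \<in> atlas M" and p: "p \<in> chart_dom c" "p \<in> chart_dom c'"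
  shows "open (coord c ` (chart_dom c \<inter> chart_dom c'))"
    and "(coord c' \<circ> uncoord c has_derivative coord_diff c c' id p) (at (coord c p))"
proof -
  show "open (coord c ` (chart_dom c \<inter> chart_dom c'))"
    using is_chart_atlas[OF M c(1)] is_chart_atlas[OF M c(2)]
    by (intro open_coord_image) (auto simp: is_chart_def)
  have "smooth_on (coord c ` (chart_dom c \<inter> chart_dom c')) (coord c' \<circ> uncoord c)"
    using M c by (auto simp: smooth_manifold_def)
  then have "coord c' \<circ> uncoord c differentiable (at (coord c p))"
    using p by (intro smooth_on_differentiable) auto
  then show "(coord c' \<circ> uncoord c has_derivative coord_diff c c' id p) (at (coord c p))"
    by (simp add: coord_diff_def frechet_derivative_works)
qed

text \<open>\<open>pullback\<close> reads the differential in a chart \<open>c'\<close> around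
  \<open>p\<close> chosen by \<open>SOME\<close>, which may differ from \<open>c\<close>. In product
  coordinates the differential of the projection is the linear projection followed by the derivative
  of the transition from \<open>c\<close> to \<open>c'\<close>, and the transformation law of
  \<open>g\<close> removes the transition.\<close>

lemma pullback_fst:
  fixes B :: "('p, 'a::euclidean_space) manifold" and d :: "('q, 'b::euclidean_space) chart"
  assumes B: "riemannian_manifold B g" and c: "c \<in> atlas B" "p \<in> chart_dom c"
    and d: "is_chart Y d" "q \<in> chart_dom d"
  shows "pullback B fst g (chart_dom c \<times> chart_dom d, map_prod (coord c) (coord d)) (p, q) U V
    = g c p (fst U) (fst V)"
proof -
  let ?C = "(chart_dom c \<times> chart_dom d, map_prod (coord c) (coord d))"
  have M: "smooth_manifold B"
    using B by (simp add: riemannian_manifold_def)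
  define c' where "c' = (SOME c. c \<in> atlas B \<and> p \<in> chart_dom c)"
  have c': "c' \<in> atlas B" "p \<in> chart_dom c'"
    unfolding c'_def using someI[of "\<lambda>c. c \<in> atlas B \<and> p \<in> chart_dom c"] c by auto
  have "((coord c' \<circ> uncoord c) has_derivative coord_diff c c' id p) (at (fst (coord c p, coord d q)))"
    using transition_has_derivative(2)[OF M c(1) c'(1) c(2) c'(2)] by simp
  from has_derivative_compose[OF has_derivative_fst[OF has_derivative_ident] this]
  have "((\<lambda>z. (coord c' \<circ> uncoord c) (fst z)) has_derivative (\<lambda>U. coord_diff c c' id p (fst U)))
    (at (coord c p, coord d q))" .
  then have "(coord c' \<circ> fst \<circ> uncoord ?C has_derivative (\<lambda>U. coord_diff c c' id p (fst U)))
    (at (coord c p, coord d q))"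
  proof (rule has_derivative_transform_within_open)
    show "open (coord c ` (chart_dom c \<inter> chart_dom c') \<times> coord d ` chart_dom d)"
      using transition_has_derivative(1)[OF M c(1) c'(1) c(2) c'(2)] d by (auto simp: is_chart_def open_Times)
    show "(coord c p, coord d q) \<in> coord c ` (chart_dom c \<inter> chart_dom c') \<times> coord d ` chart_dom d"
      using c c' d by auto
    fix z
    assume "z \<in> coord c ` (chart_dom c \<inter> chart_dom c') \<times> coord d ` chart_dom d"
    then have "fst z \<in> coord c ` chart_dom c" "snd z \<in> coord d ` chart_dom d"
      by auto
    from uncoord_prod[OF is_chart_atlas[OF M c(1)] d(1) this]
    show "(coord c' \<circ> uncoord c) (fst z) = (coord c' \<circ> fst \<circ> uncoord ?C) z"
      by simp
  qed
  from frechet_derivative_at[OF this, symmetric]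
  have "coord_diff ?C c' fst (p, q) = (\<lambda>U. coord_diff c c' id p (fst U))"
    unfolding coord_diff_def[of ?C] by simp
  then have "pullback B fst g ?C (p, q) U V = g c' p (coord_diff c c' id p (fst U)) (coord_diff c c' id p (fst V))"
    by (simp add: pullback_def Let_def flip: c'_def)
  also have "\<dots> = g c p (fst U) (fst V)"
    by (rule riemannian_metricD(5)[OF B c(1) c'(1) c(2) c'(2), symmetric])
  finally show ?thesis .
qed

lemma pullback_snd:
  fixes F :: "('q, 'b::euclidean_space) manifold" and c :: "('p, 'a::euclidean_space) chart"
  assumes F: "riemannian_manifold F g" and d: "d \<in> atlas F" "q \<in> chart_dom d"
    and c: "is_chart X c" "p \<in> chart_dom c"
  shows "pullback F snd g (chart_dom c \<times> chart_dom d, map_prod (coord c) (coord d)) (p, q) U V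
    = g d q (snd U) (snd V)"
proof -
  let ?C = "(chart_dom c \<times> chart_dom d, map_prod (coord c) (coord d))"
  have M: "smooth_manifold F"
    using F by (simp add: riemannian_manifold_def)
  define d' where "d' = (SOME d. d \<in> atlas F \<and> q \<in> chart_dom d)"
  have d': "d' \<in> atlas F" "q \<in> chart_dom d'"
    unfolding d'_def using someI[of "\<lambda>d. d \<in> atlas F \<and> q \<in> chart_dom d"] d by auto
  have "((coord d' \<circ> uncoord d) has_derivative coord_diff d d' id q) (at (snd (coord c p, coord d q)))"
    using transition_has_derivative(2)[OF M d(1) d'(1) d(2) d'(2)] by simp
  from has_derivative_compose[OF has_derivative_snd[OF has_derivative_ident] this]
  have "((\<lambda>z. (coord d' \<circ> uncoord d) (snd z)) has_derivative (\<lambda>U. coord_diff d d' id q (snd U)))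
    (at (coord c p, coord d q))" .
  then have "(coord d' \<circ> snd \<circ> uncoord ?C has_derivative (\<lambda>U. coord_diff d d' id q (snd U)))
    (at (coord c p, coord d q))"
  proof (rule has_derivative_transform_within_open)
    show "open (coord c ` chart_dom c \<times> coord d ` (chart_dom d \<inter> chart_dom d'))"
      using transition_has_derivative(1)[OF M d(1) d'(1) d(2) d'(2)] c by (auto simp: is_chart_def open_Times)
    show "(coord c p, coord d q) \<in> coord c ` chart_dom c \<times> coord d ` (chart_dom d \<inter> chart_dom d')"
      using c d' d by auto
    fix z
    assume "z \<in> coord c ` chart_dom c \<times> coord d ` (chart_dom d \<inter> chart_dom d')"
    then have "fst z \<in> coord c ` chart_dom c" "snd z \<in> coord d ` chart_dom d"
      by auto
    from uncoord_prod[OF c(1) is_chart_atlas[OF M d(1)] this]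
    show "(coord d' \<circ> uncoord d) (snd z) = (coord d' \<circ> snd \<circ> uncoord ?C) z"
      by simp
  qed
  from frechet_derivative_at[OF this, symmetric]
  have "coord_diff ?C d' snd (p, q) = (\<lambda>U. coord_diff d d' id q (snd U))"
    unfolding coord_diff_def[of ?C] by simp
  then have "pullback F snd g ?C (p, q) U V = g d' q (coord_diff d d' id q (snd U)) (coord_diff d d' id q (snd V))"
    by (simp add: pullback_def Let_def flip: d'_def)
  also have "\<dots> = g d q (snd U) (snd V)"
    by (rule riemannian_metricD(5)[OF F d(1) d'(1) d(2) d'(2), symmetric])
  finally show ?thesis .
qed

lemma local_warped_product_chart:
  assumes B: "riemannian_manifold B gB" and F: "riemannian_manifold F gF"
    and f: "smooth_fun B f" "\<forall>p\<in>points B. 0 < f p" and \<phi>: "smooth_fun B \<phi>"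
    and c: "c \<in> atlas B" and d: "d \<in> atlas F"
  defines "C \<equiv> (chart_dom c \<times> chart_dom d, map_prod (coord c) (coord d))"
  shows "local_warped_product (coord c ` chart_dom c) (in_coords gB c) (coord d ` chart_dom d) (in_coords gF d)
    (f \<circ> uncoord c) (\<phi> \<circ> uncoord c) (in_coords (warped_metric B gB F gF f) C) (\<phi> \<circ> fst \<circ> uncoord C)"
proof (intro local_warped_product.intro local_metric_chart[OF B c] local_metric_chart[OF F d]
    local_warped_product_axioms.intro)
  have M: "smooth_manifold B" "smooth_manifold F"
    using B F by (auto simp: riemannian_manifold_def)
  note charts = is_chart_atlas[OF M(1) c] is_chart_atlas[OF M(2) d]
  show "smooth_on (coord c ` chart_dom c) (f \<circ> uncoord c)"
    using f(1) c by (simp add: smooth_fun_def)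
  show "smooth_on (coord c ` chart_dom c) (\<phi> \<circ> uncoord c)"
    using \<phi> c by (simp add: smooth_fun_def)
  fix x assume x: "x \<in> coord c ` chart_dom c"
  show "0 < (f \<circ> uncoord c) x"
    using f(2) uncoord_in[OF x] chart_dom_subset[OF M(1) c] by auto
  fix y assume y: "y \<in> coord d ` chart_dom d"
  show "(\<phi> \<circ> fst \<circ> uncoord C) (x, y) = (\<phi> \<circ> uncoord c) x"
    by (simp add: C_def uncoord_prod[OF charts x y])
  show "in_coords (warped_metric B gB F gF f) C (x, y) U V = in_coords gB c x (fst U) (fst V)
    + ((f \<circ> uncoord c) x)\<^sup>2 * in_coords gF d y (snd U) (snd V)" for U V
    unfolding in_coords_def C_def uncoord_prod[OF charts x y] warped_metric_def
      pullback_fst[OF B c uncoord_in[OF x] charts(2) uncoord_in[OF y]]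
      pullback_snd[OF F d uncoord_in[OF y] charts(1) uncoord_in[OF x]]
    by simp
qed

lemma warped_soliton_equation:
  fixes F :: "('q, 'b::euclidean_space) manifold"
  assumes B: "riemannian_manifold B gB" and F: "riemannian_manifold F gF"
    and f: "smooth_fun B f" "\<forall>p\<in>points B. 0 < f p" and \<phi>: "smooth_fun B \<phi>"
    and sol: "gradient_ricci_soliton (prod_manifold B F) (warped_metric B gB F gF f) (\<phi> \<circ> fst) lam"
    and c: "c \<in> atlas B" "x \<in> coord c ` chart_dom c" and d: "d \<in> atlas F" "y \<in> coord d ` chart_dom d"
  defines "g \<equiv> in_coords gB c" and "u \<equiv> f \<circ> uncoord c"
  shows "ricci (in_coords gF d) y v v = in_coords gF d y v v *
    (lam * (u x)\<^sup>2 + u x * divergence g (grad g u) x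
    + (real DIM('b) - 1) * dir_deriv u (grad g u x) x - u x * dir_deriv (\<phi> \<circ> uncoord c) (grad g u x) x)"
proof -
  define C where "C = (chart_dom c \<times> chart_dom d, map_prod (coord c) (coord d))"
  interpret local_warped_product "coord c ` chart_dom c" g "coord d ` chart_dom d" "in_coords gF d"
    u "\<phi> \<circ> uncoord c" "in_coords (warped_metric B gB F gF f) C" "\<phi> \<circ> fst \<circ> uncoord C"
    unfolding g_def u_def C_def by (rule local_warped_product_chart[OF B F f \<phi> c(1) d(1)])
  have M: "smooth_manifold B" "smooth_manifold F"
    using B F by (auto simp: riemannian_manifold_def)
  have "C \<in> atlas (prod_manifold B F)"
    unfolding C_def prod_manifold_def using c(1) d(1) by (simp del: split_paired_Ex) blast
  moreover have "(uncoord c x, uncoord d y) \<in> chart_dom C"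
    using uncoord_in[OF c(2)] uncoord_in[OF d(2)] by (simp add: C_def)
  moreover have "coord C (uncoord c x, uncoord d y) = (x, y)"
    using coord_uncoord[OF c(2)] coord_uncoord[OF d(2)] by (simp add: C_def)
  moreover have "uncoord C (x, y) = (uncoord c x, uncoord d y)"
    unfolding C_def by (rule uncoord_prod[OF is_chart_atlas[OF M(1) c(1)] is_chart_atlas[OF M(2) d(1)] c(2) d(2)])
  ultimately have "ricci (in_coords (warped_metric B gB F gF f) C) (x, y) U V
      + hessian (in_coords (warped_metric B gB F gF f) C) (\<phi> \<circ> fst \<circ> uncoord C) (x, y) U V
      = lam * in_coords (warped_metric B gB F gF f) C (x, y) U V" for U V
    using sol unfolding gradient_ricci_soliton_def ricci_tensor_def hessian_tensor_def in_coords_def[of _ C "(x, y)"]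
    by metis
  from soliton_vertical[OF c(2) d(2) this] show ?thesis .
qed

section \<open>Constancy of the warping function\<close>

theorem theorem1:
  fixes B :: "('p, 'a::euclidean_space) manifold" and gB :: "('p, 'a) tensor2"
    and F :: "('q, 'b::euclidean_space) manifold" and gF :: "('q, 'b) tensor2"
    and f \<phi> :: "'p \<Rightarrow> real" and lam :: real
  assumes "riemannian_manifold B gB"
    and "riemannian_manifold F gF"
    and "2 \<le> DIM('b)"
    and "smooth_fun B f" and "\<forall>p\<in>points B. 0 < f p"
    and "smooth_fun B \<phi>"
    and "gradient_ricci_soliton (prod_manifold B F) (warped_metric B gB F gF f) (\<phi> \<circ> fst) lam"
    and "lam \<le> 0"
    and "\<exists>p\<in>points B. \<forall>x\<in>points B. f x \<le> f p"
    and "\<exists>q\<in>points B. \<forall>x\<in>points B. f q \<le> f x"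
  shows "\<exists>k. \<forall>x\<in>points B. f x = k"
proof -
  note B = assms(1) and F = assms(2) and f = assms(4,5) and \<phi> = assms(6) and sol = assms(7)
  have M: "smooth_manifold B" "smooth_manifold F"
    using B F by (auto simp: riemannian_manifold_def)
  obtain p where p: "p \<in> points B" and max: "\<And>x. x \<in> points B \<Longrightarrow> f x \<le> f p"
    using assms(9) by blast
  obtain q where q: "q \<in> points B" and min: "\<And>x. x \<in> points B \<Longrightarrow> f q \<le> f x"
    using assms(10) by blast
  have "points F \<noteq> {}"
    using M(2) by (simp add: smooth_manifold_def)
  then obtain d z where d: "d \<in> atlas F" "z \<in> chart_dom d"
    using chart_at[OF M(2)] by blast
  then have y: "coord d z \<in> coord d ` chart_dom d" (is "?y \<in> _")
    by simp
  obtain v :: 'b where v: "v \<noteq> 0"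
    using nonempty_Basis nonzero_Basis by blast
  define \<kappa> where "\<kappa> = in_coords gF d ?y v v"
  have "0 < \<kappa>"
    unfolding \<kappa>_def using local_metric.pos[OF local_metric_chart[OF F d(1)] y v] .
  \<comment> \<open>Depends only on the point and the vector fixed in \<open>F\<close>, so
    \<open>eq\<close> below holds with the same \<mu> in all charts of \<open>B\<close>.\<close>
  define \<mu> where "\<mu> = ricci (in_coords gF d) ?y v v / \<kappa>"
  let ?g = "\<lambda>c. in_coords gB c" and ?f = "\<lambda>c. f \<circ> uncoord c" and ?\<phi> = "\<lambda>c. \<phi> \<circ> uncoord c"
  have eq: "lam * (?f c x)\<^sup>2 + ?f c x * divergence (?g c) (grad (?g c) (?f c)) x
    + (real DIM('b) - 1) * dir_deriv (?f c) (grad (?g c) (?f c) x) x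
    - ?f c x * dir_deriv (?\<phi> c) (grad (?g c) (?f c) x) x = \<mu>"
    if "c \<in> atlas B" "x \<in> coord c ` chart_dom c" for c x
    using warped_soliton_equation[OF B F f \<phi> sol that d(1) y, of v] \<open>0 < \<kappa>\<close>
    by (simp add: \<mu>_def \<kappa>_def)
  have chart_smooth: "smooth_on (coord c ` chart_dom c) (?f c)" "smooth_on (coord c ` chart_dom c) (?\<phi> c)"
    if "c \<in> atlas B" for c
    using f(1) \<phi> that by (auto simp: smooth_fun_def)
  have in_B: "uncoord c x \<in> points B" if "c \<in> atlas B" "x \<in> coord c ` chart_dom c" for c x
    using uncoord_in[OF that(2)] chart_dom_subset[OF M(1) that(1)] by auto
  have critical: "\<mu> = lam * (?f c x)\<^sup>2 + ?f c x * divergence (?g c) (grad (?g c) (?f c)) x"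
    if c: "c \<in> atlas B" "x \<in> coord c ` chart_dom c" and crit: "\<And>v. dir_deriv (?f c) v x = 0" for c x
  proof -
    interpret local_metric "coord c ` chart_dom c" "?g c"
      by (rule local_metric_chart[OF B c(1)])
    have "grad (?g c) (?f c) x = 0"
      by (simp add: grad_def crit)
    then show ?thesis
      using eq[OF c] crit linear_0[OF linear_dir_deriv[OF chart_smooth(2)[OF c(1)] c(2)]] by simp
  qed
  have \<mu>_max: "\<mu> \<le> lam * (f p)\<^sup>2"
  proof -
    obtain c where c: "c \<in> atlas B" "p \<in> chart_dom c"
      using chart_at[OF M(1) p] by blast
    interpret local_metric "coord c ` chart_dom c" "?g c"
      by (rule local_metric_chart[OF B c(1)])
    have fp: "?f c (coord c p) = f p"
      by (simp add: uncoord_coord[OF is_chart_atlas[OF M(1) c(1)] c(2)])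
    have x: "coord c p \<in> coord c ` chart_dom c"
      using c by simp
    have "?f c y \<le> ?f c (coord c p)" if "y \<in> coord c ` chart_dom c" for y
      using max[OF in_B[OF c(1) that]] fp by simp
    note lap = laplacian_at_max[where u="?f c", OF x chart_smooth(1)[OF c(1)] this]
    have "f p * divergence (?g c) (grad (?g c) (?f c)) (coord c p) \<le> 0"
      using f(2) p by (intro mult_nonneg_nonpos lap(2)) (simp add: less_imp_le)
    then show ?thesis
      using critical[OF c(1) x lap(1)] unfolding fp by simp
  qed
  have \<mu>_min: "lam * (f q)\<^sup>2 \<le> \<mu>"
  proof -
    obtain c where c: "c \<in> atlas B" "q \<in> chart_dom c"
      using chart_at[OF M(1) q] by blast
    interpret local_metric "coord c ` chart_dom c" "?g c"
      by (rule local_metric_chart[OF B c(1)])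
    have fq: "?f c (coord c q) = f q"
      by (simp add: uncoord_coord[OF is_chart_atlas[OF M(1) c(1)] c(2)])
    have x: "coord c q \<in> coord c ` chart_dom c"
      using c by simp
    have "?f c (coord c q) \<le> ?f c y" if "y \<in> coord c ` chart_dom c" for y
      using min[OF in_B[OF c(1) that]] fq by simp
    note lap = laplacian_at_min[where u="?f c", OF x chart_smooth(1)[OF c(1)] this]
    have "0 \<le> f q * divergence (?g c) (grad (?g c) (?f c)) (coord c q)"
      using f(2) q by (intro mult_nonneg_nonneg lap(2)) (simp add: less_imp_le)
    then show ?thesis
      using critical[OF c(1) x lap(1)] unfolding fq by simp
  qed
  show ?thesis
  proof (cases "lam = 0")
    case False
    then have "(f p)\<^sup>2 \<le> (f q)\<^sup>2"
      using \<mu>_min \<mu>_max assms(8) by (smt (verit) mult_less_cancel_left)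
    then have "f p \<le> f q"
      using f(2) q by (auto intro: power2_le_imp_le less_imp_le)
    then have "f x = f p" if "x \<in> points B" for x
      using max[OF that] min[OF that] by linarith
    then show ?thesis
      by blast
  next
    case True
    then have "\<mu> = 0"
      using \<mu>_max \<mu>_min by simp
    define W where "W = {x \<in> points B. f x = f p}"
    have "openin (topo B) W"
    proof (subst openin_subopen, intro ballI)
      fix x assume x: "x \<in> W"
      then obtain c where c: "c \<in> atlas B" "x \<in> chart_dom c"
        using chart_at[OF M(1), of x] unfolding W_def by blast
      note chart = is_chart_atlas[OF M(1) c(1)]
      interpret local_metric "coord c ` chart_dom c" "?g c"
        by (rule local_metric_chart[OF B c(1)])
      have fx: "?f c (coord c x) = f p"
        using x uncoord_coord[OF chart c(2)] by (simp add: W_def)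
      \<comment> \<open>A point of \<open>W\<close> is itself a global maximum point of
        \<open>f\<close>, so the maximum principle applies at it in any chart around it and yields a
        coordinate ball on which \<open>f\<close> is constant.\<close>
      have "\<exists>r>0. \<forall>y\<in>ball (coord c x) r. ?f c y = ?f c (coord c x)"
      proof (rule strong_maximum_laplacian[OF chart_smooth[OF c(1)], where c="real DIM('b) - 1"])
        show "0 < ?f c y" if "y \<in> coord c ` chart_dom c" for y
          using f(2) in_B[OF c(1) that] by simp
        show "?f c y \<le> ?f c (coord c x)" if "y \<in> coord c ` chart_dom c" for y
          using max[OF in_B[OF c(1) that]] fx by simp
        show "?f c y * divergence (?g c) (grad (?g c) (?f c)) y
          + (real DIM('b) - 1) * dir_deriv (?f c) (grad (?g c) (?f c) y) y
          - ?f c y * dir_deriv (?\<phi> c) (grad (?g c) (?f c) y) y = 0" if "y \<in> coord c ` chart_dom c" for y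
          using eq[OF c(1) that] True \<open>\<mu> = 0\<close> by simp
      qed (use c in auto)
      then obtain r where r: "0 < r" "\<And>y. y \<in> ball (coord c x) r \<Longrightarrow> ?f c y = f p"
        unfolding fx by blast
      have "{y \<in> chart_dom c. coord c y \<in> ball (coord c x) r} \<subseteq> W"
      proof
        fix y assume "y \<in> {y \<in> chart_dom c. coord c y \<in> ball (coord c x) r}"
        then show "y \<in> W"
          using r(2)[of "coord c y"] uncoord_coord[OF chart, of y] chart_dom_subset[OF M(1) c(1)]
          by (auto simp: W_def)
      qed
      then show "\<exists>T. openin (topo B) T \<and> x \<in> T \<and> T \<subseteq> W"
        using c(2) r(1)
        by (intro exI[of _ "{y \<in> chart_dom c. coord c y \<in> ball (coord c x) r}"] conjI
            openin_chart_preimage[OF chart open_ball]) simp_all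
    qed
    moreover have "openin (topo B) (points B - W)"
    proof (subst openin_subopen, intro ballI)
      fix x assume x: "x \<in> points B - W"
      then obtain c where c: "c \<in> atlas B" "x \<in> chart_dom c"
        using chart_at[OF M(1)] by blast
      note chart = is_chart_atlas[OF M(1) c(1)]
      \<comment> \<open>Smoothness of \<open>f\<close>, and with it continuity, is expressed through
        charts, so the complement is shown to be open chart by chart.\<close>
      let ?V = "coord c ` chart_dom c \<inter> ?f c -` (- {f p})"
      have "open ?V"
        using smooth_on_continuous[OF chart_smooth(1)[OF c(1)]] chart
        by (intro continuous_open_preimage) (auto simp: is_chart_def)
      from openin_chart_preimage[OF chart this]
      have "openin (topo B) {y \<in> chart_dom c. coord c y \<in> ?V}" .
      moreover have "{y \<in> chart_dom c. coord c y \<in> ?V} = {y \<in> chart_dom c. f y \<noteq> f p}"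
        by (intro Collect_cong conj_cong refl) (simp add: uncoord_coord[OF chart] imageI)
      ultimately show "\<exists>T. openin (topo B) T \<and> x \<in> T \<and> T \<subseteq> points B - W"
        using x c(2) chart_dom_subset[OF M(1) c(1)]
        by (intro exI[of _ "{y \<in> chart_dom c. f y \<noteq> f p}"]) (auto simp: W_def)
    qed
    moreover have "connected_space (topo B)"
      using M(1) by (simp add: smooth_manifold_def)
    moreover have "W \<subseteq> points B" "W \<noteq> {}"
      using p by (auto simp: W_def)
    ultimately have "W = points B"
      unfolding connected_space_clopen_in closedin_def by blast
    then show ?thesis
      by (auto simp: W_def)
  qed
qed

end
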